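(* Let $P$ be a normal logic program which is correct under the well-founded semantics with respect to a specification $(\mathit{Snf},\mathit{St})$, over an extended language. Then $P$ is SLS-semi-complete (and hence semi-complete under the well-founded semantics) with respect to $(\mathit{Snf},\mathit{St})$.
   Context: Programs are finite sets of normal clauses; a query is a finite conjunction of literals. $\mathcal{HB}$ is the Herbrand base; for $S\subseteq\mathcal{HB}$, $\neg S=\{\neg A\mid A\in S\}$. A specification is a pair $(\mathit{Snf},\mathit{St})$ of subsets of $\mathcal{HB}$. For each predicate $p$ other than $=$ a new predicate $p'$ is introduced; for a query or its negation $F$, $F'$ replaces $p$ by $p'$ in every negative literal and $F''$ in every positive literal; for $I\subseteq\mathcal{HB}$, $I'$ renames every $p$ to $p'$. $\models$ is two-valued consequence, free variables universally closed. $WF(P)$ is the well-founded model of $P$ (a 3-valued Herbrand interpretation, a subset of $\mathcal{HB}\cup\neg\mathcal{HB}$), and $\models_3$ is truth in it in Kleene's 3-valued logic. $P$ is correct under the well-founded semantics w.r.t. $(\mathit{Snf},\mathit{St})$ if $WF(P)\subseteq \mathit{St}\cup\neg(\mathcal{HB}\setminus\mathit{Snf})$. $P$ is complete for a query $Q$ under WFS if $\mathit{St}\cup\mathit{Snf}'\models Q''$ implies $WF(P)\models_3 Q$, and $\mathit{St}\cup\mathit{Snf}'\models\neg Q'$ implies $WF(P)\models_3\neg Q$. $P$ is semi-complete under WFS if it is complete for every query for which a non-diverging main SLS-tree exists. $P$ is SLS-semi-complete if for every query $Q$, every non-diverging main SLS-tree $T$ for $P$ and $Q$, and every instance $Q\theta$: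 $\mathit{St}\cup\mathit{Snf}'\models Q''\theta$ implies $T$ has a computed answer more general than $Q\theta$, and $\mathit{St}\cup\mathit{Snf}'\models\neg Q'$ implies $T$ fails. An extended language has infinitely many constants, or a function symbol not occurring in the program and queries. SLS-resolution is taken abstractly: it is sound (if $Q$ fails then $WF(P)\models_3\neg Q$; a computed answer $Q\theta$ satisfies $WF(P)\models_3 Q\theta$); failure and success with a most general answer (a variant of the query) are preserved under instantiation. Some negative literals are "dealt with": if $\neg A$ is dealt with then $A$ fails or succeeds with a most general answer; each ground $\neg A$ with $A$ failing or succeeding is dealt with; instances of dealt-with literals are dealt with. A main SLS-tree for $P$, $Q$, selection rule $\mathcal R$: nodes are queries, root $Q$, a literal selected in each non-empty node; for a positive selected literal children are as in an SLD-tree, and a childless such node is marked failed; for selected $\neg A$ in $\vec A,\neg A,\vec B$: if not dealt with, leaf marked floundered; if dealt with and $A$ succeeds with a most general answer, leaf marked failed; if dealt with and $A$ fails, single child $\vec A,\vec B$. The tree fails if all its leaves are marked failed (it may be infinite). Computed answers are $Q\theta$ with $\theta$ the composition of mgu's along a branch ending in the empty query. The tree is non-diverging if it has no floundered leaf. *)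

theory Defs
  imports Main
begin

section \<open>Terms, atoms, clauses, queries\<close>

datatype 'f trm = Var nat | Fun 'f "'f trm list"

datatype ('f, 'p) atom = Atom 'p "'f trm list"

datatype ('f, 'p) lit = Pos "('f, 'p) atom" | Neg "('f, 'p) atom"

type_synonym ('f, 'p) query = "('f, 'p) lit list"

datatype ('f, 'p) clause = Clause (head: "('f, 'p) atom") (body: "('f, 'p) query")

type_synonym 'f subst = "nat \<Rightarrow> 'f trm"

fun subst_trm :: "'f subst \<Rightarrow> 'f trm \<Rightarrow> 'f trm" where
  "subst_trm \<theta> (Var x) = \<theta> x"
| "subst_trm \<theta> (Fun f ts) = Fun f (map (subst_trm \<theta>) ts)"

fun subst_atom :: "'f subst \<Rightarrow> ('f, 'p) atom \<Rightarrow> ('f, 'p) atom" where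
  "subst_atom \<theta> (Atom p ts) = Atom p (map (subst_trm \<theta>) ts)"

fun subst_lit :: "'f subst \<Rightarrow> ('f, 'p) lit \<Rightarrow> ('f, 'p) lit" where
  "subst_lit \<theta> (Pos A) = Pos (subst_atom \<theta> A)"
| "subst_lit \<theta> (Neg A) = Neg (subst_atom \<theta> A)"

definition subst_query :: "'f subst \<Rightarrow> ('f, 'p) query \<Rightarrow> ('f, 'p) query" where
  "subst_query \<theta> Q = map (subst_lit \<theta>) Q"

definition subst_clause :: "'f subst \<Rightarrow> ('f, 'p) clause \<Rightarrow> ('f, 'p) clause" where
  "subst_clause \<theta> c = Clause (subst_atom \<theta> (head c)) (subst_query \<theta> (body c))"

text \<open>Composition in the order of logic programming: first \<open>\<sigma>\<close>, then \<open>\<tau>\<close>.\<close>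

definition subst_comp :: "'f subst \<Rightarrow> 'f subst \<Rightarrow> 'f subst" where
  "subst_comp \<sigma> \<tau> = (\<lambda>x. subst_trm \<tau> (\<sigma> x))"

fun vars_trm :: "'f trm \<Rightarrow> nat set" where
  "vars_trm (Var x) = {x}"
| "vars_trm (Fun f ts) = (\<Union>t\<in>set ts. vars_trm t)"

fun vars_atom :: "('f, 'p) atom \<Rightarrow> nat set" where
  "vars_atom (Atom p ts) = (\<Union>t\<in>set ts. vars_trm t)"

fun atom_of :: "('f, 'p) lit \<Rightarrow> ('f, 'p) atom" where
  "atom_of (Pos A) = A"
| "atom_of (Neg A) = A"

definition vars_query :: "('f, 'p) query \<Rightarrow> nat set" where
  "vars_query Q = (\<Union>l\<in>set Q. vars_atom (atom_of l))"

definition vars_clause :: "('f, 'p) clause \<Rightarrow> nat set" where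
  "vars_clause c = vars_atom (head c) \<union> vars_query (body c)"

definition dom_subst :: "'f subst \<Rightarrow> nat set" where
  "dom_subst \<theta> = {x. \<theta> x \<noteq> Var x}"

definition vars_subst :: "'f subst \<Rightarrow> nat set" where
  "vars_subst \<theta> = dom_subst \<theta> \<union> (\<Union>x\<in>dom_subst \<theta>. vars_trm (\<theta> x))"

text \<open>Function symbols are identified together with their arity; constants have arity 0.\<close>

fun funs_trm :: "'f trm \<Rightarrow> ('f \<times> nat) set" where
  "funs_trm (Var x) = {}"
| "funs_trm (Fun f ts) = insert (f, length ts) (\<Union>t\<in>set ts. funs_trm t)"

fun funs_atom :: "('f, 'p) atom \<Rightarrow> ('f \<times> nat) set" where
  "funs_atom (Atom p ts) = (\<Union>t\<in>set ts. funs_trm t)"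

fun pred_atom :: "('f, 'p) atom \<Rightarrow> 'p \<times> nat" where
  "pred_atom (Atom p ts) = (p, length ts)"

definition funs_query :: "('f, 'p) query \<Rightarrow> ('f \<times> nat) set" where
  "funs_query Q = (\<Union>l\<in>set Q. funs_atom (atom_of l))"

definition funs_clause :: "('f, 'p) clause \<Rightarrow> ('f \<times> nat) set" where
  "funs_clause c = funs_atom (head c) \<union> funs_query (body c)"


section \<open>Languages, programs, Herbrand base\<close>

record ('f, 'p) language =
  funs :: "('f \<times> nat) set"
  preds :: "('p \<times> nat) set"

text \<open>The Herbrand universe is nonempty.\<close>

definition is_language :: "('f, 'p) language \<Rightarrow> bool" where
  "is_language L \<longleftrightarrow> (\<exists>a. (a, 0) \<in> funs L)"

definition trms :: "('f, 'p) language \<Rightarrow> 'f trm set" where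
  "trms L = {t. funs_trm t \<subseteq> funs L}"

definition atoms :: "('f, 'p) language \<Rightarrow> ('f, 'p) atom set" where
  "atoms L = {A. pred_atom A \<in> preds L \<and> funs_atom A \<subseteq> funs L}"

definition queries :: "('f, 'p) language \<Rightarrow> ('f, 'p) query set" where
  "queries L = {Q. \<forall>l\<in>set Q. atom_of l \<in> atoms L}"

definition clauses :: "('f, 'p) language \<Rightarrow> ('f, 'p) clause set" where
  "clauses L = {c. head c \<in> atoms L \<and> body c \<in> queries L}"

definition substs :: "('f, 'p) language \<Rightarrow> 'f subst set" where
  "substs L = {\<theta>. finite (dom_subst \<theta>) \<and> (\<forall>x. \<theta> x \<in> trms L)}"

definition is_program :: "('f, 'p) language \<Rightarrow> ('f, 'p) clause set \<Rightarrow> bool" where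
  "is_program L P \<longleftrightarrow> finite P \<and> P \<subseteq> clauses L"

definition HB :: "('f, 'p) language \<Rightarrow> ('f, 'p) atom set" where
  "HB L = {A \<in> atoms L. vars_atom A = {}}"

definition ground_clauses ::
    "('f, 'p) language \<Rightarrow> ('f, 'p) clause set \<Rightarrow> ('f, 'p) clause set" where
  "ground_clauses L P =
     {subst_clause \<theta> c | \<theta> c. c \<in> P \<and> \<theta> \<in> substs L \<and> vars_clause (subst_clause \<theta> c) = {}}"

text \<open>
  The class \<open>Qs\<close> of queries under consideration is explicit, because an added function symbol
  must occur neither in the program nor in any query considered. Constants are accounted for
  by the first disjunct, so the added function symbol has positive arity: one new constant
  would not be enough to separate two variables.
\<close>

definition extended_language ::
    "('f, 'p) language \<Rightarrow> ('f, 'p) clause set \<Rightarrow> ('f, 'p) query set \<Rightarrow> bool" where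
  "extended_language L P Qs \<longleftrightarrow>
     infinite {a. (a, 0) \<in> funs L} \<or>
     (\<exists>f n. n > 0 \<and> (f, n) \<in> funs L \<and>
        (\<forall>c\<in>P. (f, n) \<notin> funs_clause c) \<and> (\<forall>Q\<in>Qs. (f, n) \<notin> funs_query Q))"


section \<open>Formulas, two-valued and three-valued truth\<close>

datatype ('f, 'p) formula = Conj "('f, 'p) query" | NotConj "('f, 'p) query"

fun true2_lit :: "('f, 'p) atom set \<Rightarrow> ('f, 'p) lit \<Rightarrow> bool" where
  "true2_lit I (Pos A) \<longleftrightarrow> A \<in> I"
| "true2_lit I (Neg A) \<longleftrightarrow> A \<notin> I"

text \<open>
  Truth of the universal closure in the two-valued Herbrand interpretation \<open>I\<close>. Only the
  function symbols of \<open>L\<close> matter, so \<open>I\<close> may be over more predicates than \<open>L\<close>.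
\<close>

fun models2 :: "('f, 'p) language \<Rightarrow> ('f, 'q) atom set \<Rightarrow> ('f, 'q) formula \<Rightarrow> bool" where
  "models2 L I (Conj Q) \<longleftrightarrow>
     (\<forall>\<theta>\<in>substs L. vars_query (subst_query \<theta> Q) = {} \<longrightarrow>
        (\<forall>l\<in>set (subst_query \<theta> Q). true2_lit I l))"
| "models2 L I (NotConj Q) \<longleftrightarrow>
     (\<forall>\<theta>\<in>substs L. vars_query (subst_query \<theta> Q) = {} \<longrightarrow>
        \<not> (\<forall>l\<in>set (subst_query \<theta> Q). true2_lit I l))"

datatype tv = TT | UU | FF

fun kleene_not :: "tv \<Rightarrow> tv" where
  "kleene_not TT = FF"
| "kleene_not UU = UU"
| "kleene_not FF = TT"

fun kleene_and :: "tv \<Rightarrow> tv \<Rightarrow> tv" where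
  "kleene_and FF b = FF"
| "kleene_and TT b = b"
| "kleene_and UU b = (if b = FF then FF else UU)"

text \<open>A 3-valued Herbrand interpretation is a set of ground literals.\<close>

definition val3_atom :: "('f, 'p) lit set \<Rightarrow> ('f, 'p) atom \<Rightarrow> tv" where
  "val3_atom I A = (if Pos A \<in> I then TT else if Neg A \<in> I then FF else UU)"

fun val3_lit :: "('f, 'p) lit set \<Rightarrow> ('f, 'p) lit \<Rightarrow> tv" where
  "val3_lit I (Pos A) = val3_atom I A"
| "val3_lit I (Neg A) = kleene_not (val3_atom I A)"

definition val3_query :: "('f, 'p) lit set \<Rightarrow> ('f, 'p) query \<Rightarrow> tv" where
  "val3_query I Q = foldr (\<lambda>l b. kleene_and (val3_lit I l) b) Q TT"

fun models3 :: "('f, 'p) language \<Rightarrow> ('f, 'p) lit set \<Rightarrow> ('f, 'p) formula \<Rightarrow> bool" where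
  "models3 L I (Conj Q) \<longleftrightarrow>
     (\<forall>\<theta>\<in>substs L. vars_query (subst_query \<theta> Q) = {} \<longrightarrow>
        val3_query I (subst_query \<theta> Q) = TT)"
| "models3 L I (NotConj Q) \<longleftrightarrow>
     (\<forall>\<theta>\<in>substs L. vars_query (subst_query \<theta> Q) = {} \<longrightarrow>
        kleene_not (val3_query I (subst_query \<theta> Q)) = TT)"


section \<open>The well-founded model\<close>

fun compl_lit :: "('f, 'p) lit \<Rightarrow> ('f, 'p) lit" where
  "compl_lit (Pos A) = Neg A"
| "compl_lit (Neg A) = Pos A"

definition unfounded ::
    "('f, 'p) language \<Rightarrow> ('f, 'p) clause set \<Rightarrow> ('f, 'p) lit set \<Rightarrow> ('f, 'p) atom set \<Rightarrow> bool"
  where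
  "unfounded L P I U \<longleftrightarrow> U \<subseteq> HB L \<and>
     (\<forall>c\<in>ground_clauses L P. head c \<in> U \<longrightarrow>
        (\<exists>l\<in>set (body c). compl_lit l \<in> I) \<or> (\<exists>B\<in>U. Pos B \<in> set (body c)))"

definition wf_operator ::
    "('f, 'p) language \<Rightarrow> ('f, 'p) clause set \<Rightarrow> ('f, 'p) lit set \<Rightarrow> ('f, 'p) lit set" where
  "wf_operator L P I =
     Pos ` {head c | c. c \<in> ground_clauses L P \<and> set (body c) \<subseteq> I} \<union>
     Neg ` (\<Union>{U. unfounded L P I U})"

definition WF :: "('f, 'p) language \<Rightarrow> ('f, 'p) clause set \<Rightarrow> ('f, 'p) lit set" where
  "WF L P = lfp (wf_operator L P)"


section \<open>Renaming of predicates, specifications, correctness, completeness\<close>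

text \<open>
  There is no built-in equality: a predicate \<open>=\<close> is an ordinary one, given by the clause
  \<open>x = x\<close>. If \<open>Snf\<close> and \<open>St\<close> both interpret it as identity, then renaming it does not
  affect truth in the interpretation \<open>spec_interp Snf St\<close> below.
\<close>

datatype 'p primed = Plain 'p | Primed 'p

fun rename_atom :: "('p \<Rightarrow> 'q) \<Rightarrow> ('f, 'p) atom \<Rightarrow> ('f, 'q) atom" where
  "rename_atom r (Atom p ts) = Atom (r p) ts"

fun prime_lit :: "('f, 'p) lit \<Rightarrow> ('f, 'p primed) lit" where
  "prime_lit (Pos A) = Pos (rename_atom Plain A)"
| "prime_lit (Neg A) = Neg (rename_atom Primed A)"

fun dprime_lit :: "('f, 'p) lit \<Rightarrow> ('f, 'p primed) lit" where
  "dprime_lit (Pos A) = Pos (rename_atom Primed A)"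
| "dprime_lit (Neg A) = Neg (rename_atom Plain A)"

text \<open>
  An atom is not counted as negative because of the outer negation: the positive and negative
  literals of \<open>\<not> Q\<close> are those of \<open>Q\<close>.
\<close>

fun prime :: "('f, 'p) formula \<Rightarrow> ('f, 'p primed) formula" where
  "prime (Conj Q) = Conj (map prime_lit Q)"
| "prime (NotConj Q) = NotConj (map prime_lit Q)"

fun dprime :: "('f, 'p) formula \<Rightarrow> ('f, 'p primed) formula" where
  "dprime (Conj Q) = Conj (map dprime_lit Q)"
| "dprime (NotConj Q) = NotConj (map dprime_lit Q)"

text \<open>
  \<open>St \<union> Snf'\<close> is read as a Herbrand interpretation, not as a theory consisting of ground
  atoms, which would not entail any negative literal.
\<close>

definition spec_interp ::
    "('f, 'p) atom set \<Rightarrow> ('f, 'p) atom set \<Rightarrow> ('f, 'p primed) atom set" where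
  "spec_interp Snf St = rename_atom Plain ` St \<union> rename_atom Primed ` Snf"

definition is_specification ::
    "('f, 'p) language \<Rightarrow> ('f, 'p) atom set \<Rightarrow> ('f, 'p) atom set \<Rightarrow> bool" where
  "is_specification L Snf St \<longleftrightarrow> Snf \<subseteq> HB L \<and> St \<subseteq> HB L"

definition correct_wfs ::
    "('f, 'p) language \<Rightarrow> ('f, 'p) clause set \<Rightarrow> ('f, 'p) atom set \<Rightarrow> ('f, 'p) atom set \<Rightarrow> bool"
  where
  "correct_wfs L P Snf St \<longleftrightarrow> WF L P \<subseteq> Pos ` St \<union> Neg ` (HB L - Snf)"

definition complete_for_wfs ::
    "('f, 'p) language \<Rightarrow> ('f, 'p) clause set \<Rightarrow> ('f, 'p) atom set \<Rightarrow> ('f, 'p) atom set \<Rightarrow>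
     ('f, 'p) query \<Rightarrow> bool" where
  "complete_for_wfs L P Snf St Q \<longleftrightarrow>
     (models2 L (spec_interp Snf St) (dprime (Conj Q)) \<longrightarrow> models3 L (WF L P) (Conj Q)) \<and>
     (models2 L (spec_interp Snf St) (prime (NotConj Q)) \<longrightarrow> models3 L (WF L P) (NotConj Q))"


section \<open>Abstract SLS-resolution\<close>

definition query_variant ::
    "('f, 'p) language \<Rightarrow> ('f, 'p) query \<Rightarrow> ('f, 'p) query \<Rightarrow> bool" where
  "query_variant L Q R \<longleftrightarrow>
     (\<exists>\<sigma>\<in>substs L. Q = subst_query \<sigma> R) \<and> (\<exists>\<tau>\<in>substs L. R = subst_query \<tau> Q)"

definition clause_variant ::
    "('f, 'p) language \<Rightarrow> ('f, 'p) clause \<Rightarrow> ('f, 'p) clause \<Rightarrow> bool" where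
  "clause_variant L c d \<longleftrightarrow>
     (\<exists>\<sigma>\<in>substs L. c = subst_clause \<sigma> d) \<and> (\<exists>\<tau>\<in>substs L. d = subst_clause \<tau> c)"

text \<open>
  \<open>fails S Q\<close>: \<open>Q\<close> fails; \<open>answer S Q R\<close>: \<open>R\<close> (an instance of \<open>Q\<close>) is a computed answer
  for \<open>Q\<close>; \<open>dealt S (Neg A)\<close>: the negative literal is dealt with.
\<close>

record ('f, 'p) sls =
  fails :: "('f, 'p) query \<Rightarrow> bool"
  answer :: "('f, 'p) query \<Rightarrow> ('f, 'p) query \<Rightarrow> bool"
  dealt :: "('f, 'p) lit \<Rightarrow> bool"

definition succeeds :: "('f, 'p) sls \<Rightarrow> ('f, 'p) query \<Rightarrow> bool" where
  "succeeds S Q \<longleftrightarrow> (\<exists>R. answer S Q R)"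

definition succeeds_mg :: "('f, 'p) language \<Rightarrow> ('f, 'p) sls \<Rightarrow> ('f, 'p) query \<Rightarrow> bool" where
  "succeeds_mg L S Q \<longleftrightarrow> (\<exists>R. answer S Q R \<and> query_variant L R Q)"

locale sls_resolution =
  fixes L :: "('f, 'p) language" and P :: "('f, 'p) clause set" and S :: "('f, 'p) sls"
  assumes fails_sound:
      "\<And>Q. Q \<in> queries L \<Longrightarrow> fails S Q \<Longrightarrow> models3 L (WF L P) (NotConj Q)"
    and answer_instance:
      "\<And>Q R. Q \<in> queries L \<Longrightarrow> answer S Q R \<Longrightarrow> \<exists>\<theta>\<in>substs L. R = subst_query \<theta> Q"
    and answer_sound:
      "\<And>Q R. Q \<in> queries L \<Longrightarrow> answer S Q R \<Longrightarrow> models3 L (WF L P) (Conj R)"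
    and fails_inst:
      "\<And>Q \<theta>. Q \<in> queries L \<Longrightarrow> \<theta> \<in> substs L \<Longrightarrow> fails S Q \<Longrightarrow> fails S (subst_query \<theta> Q)"
    and succeeds_mg_inst:
      "\<And>Q \<theta>. Q \<in> queries L \<Longrightarrow> \<theta> \<in> substs L \<Longrightarrow> succeeds_mg L S Q \<Longrightarrow>
        succeeds_mg L S (subst_query \<theta> Q)"
    and dealt_decided:
      "\<And>A. A \<in> atoms L \<Longrightarrow> dealt S (Neg A) \<Longrightarrow> fails S [Pos A] \<or> succeeds_mg L S [Pos A]"
    and dealt_ground:
      "\<And>A. A \<in> HB L \<Longrightarrow> fails S [Pos A] \<or> succeeds S [Pos A] \<Longrightarrow> dealt S (Neg A)"
    and dealt_inst:
      "\<And>A \<theta>. A \<in> atoms L \<Longrightarrow> \<theta> \<in> substs L \<Longrightarrow> dealt S (Neg A) \<Longrightarrow>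
        dealt S (Neg (subst_atom \<theta> A))"


section \<open>Main SLS-trees\<close>

definition unifier :: "('f, 'p) language \<Rightarrow> 'f subst \<Rightarrow> ('f, 'p) atom \<Rightarrow> ('f, 'p) atom \<Rightarrow> bool"
  where
  "unifier L \<theta> A B \<longleftrightarrow> \<theta> \<in> substs L \<and> subst_atom \<theta> A = subst_atom \<theta> B"

definition mgu :: "('f, 'p) language \<Rightarrow> 'f subst \<Rightarrow> ('f, 'p) atom \<Rightarrow> ('f, 'p) atom \<Rightarrow> bool"
  where
  "mgu L \<theta> A B \<longleftrightarrow> unifier L \<theta> A B \<and>
     (\<forall>\<tau>. unifier L \<tau> A B \<longrightarrow> (\<exists>\<delta>\<in>substs L. \<tau> = subst_comp \<theta> \<delta>))"

text \<open>
  A history is the part of a branch above a node, starting at the root: for each node passed,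
  its query, the position of the selected literal, and, for a positive literal, the clause
  variant and the mgu used (\<open>None\<close> for a negative literal that is removed).
\<close>

type_synonym ('f, 'p) history =
  "(('f, 'p) query \<times> nat \<times> (('f, 'p) clause \<times> 'f subst) option) list"

type_synonym ('f, 'p) selection_rule = "('f, 'p) history \<Rightarrow> ('f, 'p) query \<Rightarrow> nat"

definition is_selection_rule :: "('f, 'p) selection_rule \<Rightarrow> bool" where
  "is_selection_rule \<R> \<longleftrightarrow> (\<forall>h N. N \<noteq> [] \<longrightarrow> \<R> h N < length N)"

fun vars_step :: "('f, 'p) query \<times> nat \<times> (('f, 'p) clause \<times> 'f subst) option \<Rightarrow> nat set" where
  "vars_step (N, i, None) = vars_query N"
| "vars_step (N, i, Some (c, \<theta>)) = vars_query N \<union> vars_clause c \<union> vars_subst \<theta>"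

definition used_vars :: "('f, 'p) history \<Rightarrow> ('f, 'p) query \<Rightarrow> nat set" where
  "used_vars h N = vars_query N \<union> (\<Union>s\<in>set h. vars_step s)"

text \<open>Clause variants are standardized apart from everything used on the branch.\<close>

definition fresh_variant ::
    "('f, 'p) language \<Rightarrow> nat set \<Rightarrow> ('f, 'p) clause \<Rightarrow> ('f, 'p) clause \<Rightarrow> bool" where
  "fresh_variant L V c c' \<longleftrightarrow> clause_variant L c' c \<and> vars_clause c' \<inter> V = {}"

definition applicable ::
    "('f, 'p) language \<Rightarrow> nat set \<Rightarrow> ('f, 'p) atom \<Rightarrow> ('f, 'p) clause \<Rightarrow> bool" where
  "applicable L V A c \<longleftrightarrow> (\<exists>c' \<theta>. fresh_variant L V c c' \<and> unifier L \<theta> A (head c'))"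

definition resolvent ::
    "('f, 'p) query \<Rightarrow> nat \<Rightarrow> ('f, 'p) clause \<Rightarrow> 'f subst \<Rightarrow> ('f, 'p) query" where
  "resolvent N i c \<theta> = subst_query \<theta> (take i N @ body c @ drop (Suc i) N)"

text \<open>
  Trees may be infinite. \<open>Success\<close> is the node with the empty query; \<open>Failed\<close> and
  \<open>Floundered\<close> are the leaves so marked. \<open>Resolve N kids\<close> has at most one child for each
  program clause, given with the clause variant and the mgu used. \<open>Remove N t\<close> is a node with
  a selected negative literal and the single child \<open>t\<close>.
\<close>

codatatype ('f, 'p) sls_tree =
    Success
  | Failed "('f, 'p) query"
  | Floundered "('f, 'p) query"
  | Resolve "('f, 'p) query"
      "('f, 'p) clause \<Rightarrow> (('f, 'p) clause \<times> 'f subst \<times> ('f, 'p) sls_tree) option"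
  | Remove "('f, 'p) query" "('f, 'p) sls_tree"

coinductive sls_tree_at ::
    "('f, 'p) language \<Rightarrow> ('f, 'p) clause set \<Rightarrow> ('f, 'p) sls \<Rightarrow> ('f, 'p) selection_rule \<Rightarrow>
     ('f, 'p) history \<Rightarrow> ('f, 'p) query \<Rightarrow> ('f, 'p) sls_tree \<Rightarrow> bool"
  for L P S \<R> where
  success: "sls_tree_at L P S \<R> h [] Success"
| pos_failed:
    "\<lbrakk>N \<noteq> []; N ! \<R> h N = Pos A; \<forall>c\<in>P. \<not> applicable L (used_vars h N) A c\<rbrakk>
     \<Longrightarrow> sls_tree_at L P S \<R> h N (Failed N)"
| pos:
    "\<lbrakk>N \<noteq> []; i = \<R> h N; N ! i = Pos A; \<exists>c\<in>P. applicable L (used_vars h N) A c;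
      \<forall>c. kids c \<noteq> None \<longleftrightarrow> c \<in> P \<and> applicable L (used_vars h N) A c;
      \<forall>c c' \<theta> t. kids c = Some (c', \<theta>, t) \<longrightarrow>
        fresh_variant L (used_vars h N) c c' \<and> mgu L \<theta> A (head c') \<and>
        sls_tree_at L P S \<R> (h @ [(N, i, Some (c', \<theta>))]) (resolvent N i c' \<theta>) t\<rbrakk>
     \<Longrightarrow> sls_tree_at L P S \<R> h N (Resolve N kids)"
| neg_floundered:
    "\<lbrakk>N \<noteq> []; N ! \<R> h N = Neg A; \<not> dealt S (Neg A)\<rbrakk>
     \<Longrightarrow> sls_tree_at L P S \<R> h N (Floundered N)"
| neg_failed:
    "\<lbrakk>N \<noteq> []; N ! \<R> h N = Neg A; dealt S (Neg A); succeeds_mg L S [Pos A]\<rbrakk>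
     \<Longrightarrow> sls_tree_at L P S \<R> h N (Failed N)"
| neg_removed:
    "\<lbrakk>N \<noteq> []; i = \<R> h N; N ! i = Neg A; dealt S (Neg A); fails S [Pos A];
      sls_tree_at L P S \<R> (h @ [(N, i, None)]) (take i N @ drop (Suc i) N) t\<rbrakk>
     \<Longrightarrow> sls_tree_at L P S \<R> h N (Remove N t)"

definition main_sls_tree ::
    "('f, 'p) language \<Rightarrow> ('f, 'p) clause set \<Rightarrow> ('f, 'p) sls \<Rightarrow> ('f, 'p) query \<Rightarrow>
     ('f, 'p) selection_rule \<Rightarrow> ('f, 'p) sls_tree \<Rightarrow> bool" where
  "main_sls_tree L P S Q \<R> T \<longleftrightarrow> is_selection_rule \<R> \<and> sls_tree_at L P S \<R> [] Q T"

inductive_set subtrees :: "('f, 'p) sls_tree \<Rightarrow> ('f, 'p) sls_tree set" for T where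
  "T \<in> subtrees T"
| "Resolve N kids \<in> subtrees T \<Longrightarrow> kids c = Some (c', \<theta>, t) \<Longrightarrow> t \<in> subtrees T"
| "Remove N t \<in> subtrees T \<Longrightarrow> t \<in> subtrees T"

fun is_leaf :: "('f, 'p) sls_tree \<Rightarrow> bool" where
  "is_leaf Success = True"
| "is_leaf (Failed N) = True"
| "is_leaf (Floundered N) = True"
| "is_leaf (Resolve N kids) = False"
| "is_leaf (Remove N t) = False"

definition tree_fails :: "('f, 'p) sls_tree \<Rightarrow> bool" where
  "tree_fails T \<longleftrightarrow> (\<forall>t\<in>subtrees T. is_leaf t \<longrightarrow> (\<exists>N. t = Failed N))"

definition non_diverging :: "('f, 'p) sls_tree \<Rightarrow> bool" where
  "non_diverging T \<longleftrightarrow> (\<forall>t\<in>subtrees T. \<forall>N. t \<noteq> Floundered N)"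

text \<open>Composition of the mgu's along a branch that ends in the empty query.\<close>

inductive branch_subst :: "('f, 'p) sls_tree \<Rightarrow> 'f subst \<Rightarrow> bool" where
  "branch_subst Success Var"
| "kids c = Some (c', \<theta>, t) \<Longrightarrow> branch_subst t \<rho> \<Longrightarrow>
     branch_subst (Resolve N kids) (subst_comp \<theta> \<rho>)"
| "branch_subst t \<rho> \<Longrightarrow> branch_subst (Remove N t) \<rho>"

definition computed_answer :: "('f, 'p) sls_tree \<Rightarrow> ('f, 'p) query \<Rightarrow> ('f, 'p) query \<Rightarrow> bool"
  where
  "computed_answer T Q R \<longleftrightarrow> (\<exists>\<rho>. branch_subst T \<rho> \<and> R = subst_query \<rho> Q)"

definition more_general ::
    "('f, 'p) language \<Rightarrow> ('f, 'p) query \<Rightarrow> ('f, 'p) query \<Rightarrow> bool" where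
  "more_general L R R' \<longleftrightarrow> (\<exists>\<eta>\<in>substs L. R' = subst_query \<eta> R)"


section \<open>Semi-completeness\<close>

definition semi_complete_wfs ::
    "('f, 'p) language \<Rightarrow> ('f, 'p) clause set \<Rightarrow> ('f, 'p) sls \<Rightarrow> ('f, 'p) query set \<Rightarrow>
     ('f, 'p) atom set \<Rightarrow> ('f, 'p) atom set \<Rightarrow> bool" where
  "semi_complete_wfs L P S Qs Snf St \<longleftrightarrow>
     (\<forall>Q\<in>Qs. (\<exists>\<R> T. main_sls_tree L P S Q \<R> T \<and> non_diverging T) \<longrightarrow>
        complete_for_wfs L P Snf St Q)"

definition sls_semi_complete ::
    "('f, 'p) language \<Rightarrow> ('f, 'p) clause set \<Rightarrow> ('f, 'p) sls \<Rightarrow> ('f, 'p) query set \<Rightarrow>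
     ('f, 'p) atom set \<Rightarrow> ('f, 'p) atom set \<Rightarrow> bool" where
  "sls_semi_complete L P S Qs Snf St \<longleftrightarrow>
     (\<forall>Q\<in>Qs. \<forall>\<R> T. main_sls_tree L P S Q \<R> T \<and> non_diverging T \<longrightarrow>
        (\<forall>\<theta>\<in>substs L.
           (models2 L (spec_interp Snf St) (dprime (Conj (subst_query \<theta> Q))) \<longrightarrow>
              (\<exists>R. computed_answer T Q R \<and> more_general L R (subst_query \<theta> Q))) \<and>
           (models2 L (spec_interp Snf St) (prime (NotConj Q)) \<longrightarrow> tree_fails T)))"

end

theory Submission
  imports Defs
begin

text \<open>
  By correctness, a query that the specification does not refute has no ground instance with a
  literal false in \<open>WF L P\<close>. A ground atom that is not false has a finite proof tree whose negative
  leaves are not false, since the atoms without one form an unfounded set. Such a finite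
  proof is lifted along the main SLS-tree by induction on its size; a selected negative literal
  that is dealt with cannot fail the branch, for then its atom would be true. Hence a
  non-diverging tree contains a success branch. To get an answer more general than a non-ground
  \<open>Q\<theta>\<close>, its variables are instantiated by distinct ground terms that the clauses cannot
  inspect, and in the resulting proof these terms are replaced by the variables again before
  lifting. Failure follows from the soundness of success branches.
\<close>

section \<open>Substitutions\<close>

lemma subst_trm_comp: "subst_trm (subst_comp \<sigma> \<tau>) t = subst_trm \<tau> (subst_trm \<sigma> t)"
  by (induction t) (auto simp: subst_comp_def)

lemma subst_atom_comp: "subst_atom (subst_comp \<sigma> \<tau>) A = subst_atom \<tau> (subst_atom \<sigma> A)"
  by (cases A) (simp add: subst_trm_comp)

lemma subst_lit_comp: "subst_lit (subst_comp \<sigma> \<tau>) l = subst_lit \<tau> (subst_lit \<sigma> l)"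
  by (cases l) (simp_all add: subst_atom_comp)

lemma subst_query_comp: "subst_query (subst_comp \<sigma> \<tau>) Q = subst_query \<tau> (subst_query \<sigma> Q)"
  by (simp add: subst_query_def subst_lit_comp)

lemma subst_clause_comp: "subst_clause (subst_comp \<sigma> \<tau>) c = subst_clause \<tau> (subst_clause \<sigma> c)"
  by (simp add: subst_clause_def subst_atom_comp subst_query_comp)

lemma subst_trm_cong: "(\<And>x. x \<in> vars_trm t \<Longrightarrow> \<sigma> x = \<tau> x) \<Longrightarrow> subst_trm \<sigma> t = subst_trm \<tau> t"
  by (induction t) auto

lemma subst_atom_cong: "(\<And>x. x \<in> vars_atom A \<Longrightarrow> \<sigma> x = \<tau> x) \<Longrightarrow> subst_atom \<sigma> A = subst_atom \<tau> A"
  by (cases A) (auto intro!: subst_trm_cong)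

lemma subst_lit_cong:
  "(\<And>x. x \<in> vars_atom (atom_of l) \<Longrightarrow> \<sigma> x = \<tau> x) \<Longrightarrow> subst_lit \<sigma> l = subst_lit \<tau> l"
  by (cases l) (auto intro!: subst_atom_cong)

lemma subst_query_cong: "(\<And>x. x \<in> vars_query Q \<Longrightarrow> \<sigma> x = \<tau> x) \<Longrightarrow> subst_query \<sigma> Q = subst_query \<tau> Q"
  by (auto simp: subst_query_def vars_query_def intro!: subst_lit_cong)

lemma subst_clause_cong:
  "(\<And>x. x \<in> vars_clause c \<Longrightarrow> \<sigma> x = \<tau> x) \<Longrightarrow> subst_clause \<sigma> c = subst_clause \<tau> c"
  by (auto simp: subst_clause_def vars_clause_def intro!: subst_atom_cong subst_query_cong)

lemma subst_trm_Var [simp]: "subst_trm Var t = t"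
  by (induction t) (auto intro: map_idI)

lemma subst_atom_Var [simp]: "subst_atom Var A = A"
  by (cases A) (auto intro: map_idI)

lemma subst_lit_Var [simp]: "subst_lit Var l = l"
  by (cases l) auto

lemma subst_query_Var [simp]: "subst_query Var Q = Q"
  by (auto simp: subst_query_def intro: map_idI)

lemma subst_clause_Var [simp]: "subst_clause Var c = c"
  by (simp add: subst_clause_def)

lemma atom_of_subst_lit [simp]: "atom_of (subst_lit \<theta> l) = subst_atom \<theta> (atom_of l)"
  by (cases l) auto

lemma vars_subst_trm: "vars_trm (subst_trm \<theta> t) = (\<Union>x\<in>vars_trm t. vars_trm (\<theta> x))"
  by (induction t) auto

lemma vars_subst_atom: "vars_atom (subst_atom \<theta> A) = (\<Union>x\<in>vars_atom A. vars_trm (\<theta> x))"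
  by (cases A) (auto simp: vars_subst_trm)

lemma vars_subst_query: "vars_query (subst_query \<theta> Q) = (\<Union>x\<in>vars_query Q. vars_trm (\<theta> x))"
  by (auto simp: vars_query_def subst_query_def vars_subst_atom)

lemma vars_subst_clause: "vars_clause (subst_clause \<theta> c) = (\<Union>x\<in>vars_clause c. vars_trm (\<theta> x))"
  by (auto simp: vars_clause_def subst_clause_def vars_subst_atom vars_subst_query)

section \<open>Finiteness of variables and function symbols\<close>

lemma finite_vars_trm [simp]: "finite (vars_trm t)"
  by (induction t) auto

lemma finite_vars_atom [simp]: "finite (vars_atom A)"
  by (cases A) auto

lemma finite_vars_query [simp]: "finite (vars_query Q)"
  by (simp add: vars_query_def)

lemma finite_vars_clause [simp]: "finite (vars_clause c)"
  by (simp add: vars_clause_def)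

lemma finite_funs_trm [simp]: "finite (funs_trm t)"
  by (induction t) auto

lemma finite_funs_atom [simp]: "finite (funs_atom A)"
  by (cases A) auto

lemma finite_funs_query [simp]: "finite (funs_query Q)"
  by (simp add: funs_query_def)

lemma finite_funs_clause [simp]: "finite (funs_clause c)"
  by (simp add: funs_clause_def)

section \<open>Closure of the language under substitutions of finite domain\<close>

lemma subst_trm_in_trms: "t \<in> trms L \<Longrightarrow> (\<And>x. \<theta> x \<in> trms L) \<Longrightarrow> subst_trm \<theta> t \<in> trms L"
  by (induction t) (simp_all add: trms_def UN_subset_iff)

lemma subst_atom_in_atoms:
  assumes "A \<in> atoms L" "\<And>x. \<theta> x \<in> trms L"
  shows "subst_atom \<theta> A \<in> atoms L"
proof -
  have "subst_trm \<theta> t \<in> trms L" if "t \<in> trms L" for t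
    using that assms(2) by (rule subst_trm_in_trms)
  with assms(1) show ?thesis
    by (cases A) (auto simp: atoms_def trms_def UN_subset_iff)
qed

lemma subst_query_in_queries:
  "Q \<in> queries L \<Longrightarrow> (\<And>x. \<theta> x \<in> trms L) \<Longrightarrow> subst_query \<theta> Q \<in> queries L"
  by (auto simp: queries_def subst_query_def intro: subst_atom_in_atoms)

lemma subst_clause_in_clauses:
  "c \<in> clauses L \<Longrightarrow> (\<And>x. \<theta> x \<in> trms L) \<Longrightarrow> subst_clause \<theta> c \<in> clauses L"
  by (auto simp: clauses_def subst_clause_def intro: subst_atom_in_atoms subst_query_in_queries)

lemma Var_in_trms [simp]: "Var x \<in> trms L"
  by (simp add: trms_def)

lemma substs_in_trms: "\<theta> \<in> substs L \<Longrightarrow> \<theta> x \<in> trms L"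
  by (simp add: substs_def)

lemma Var_in_substs [simp]: "Var \<in> substs L"
  by (simp add: substs_def dom_subst_def)

lemma subst_comp_in_substs:
  assumes "\<sigma> \<in> substs L" "\<tau> \<in> substs L"
  shows "subst_comp \<sigma> \<tau> \<in> substs L"
proof -
  have "dom_subst (subst_comp \<sigma> \<tau>) \<subseteq> dom_subst \<sigma> \<union> dom_subst \<tau>"
    by (auto simp: dom_subst_def subst_comp_def)
  then have "finite (dom_subst (subst_comp \<sigma> \<tau>))"
    using assms by (auto simp: substs_def intro: finite_subset)
  moreover have "subst_comp \<sigma> \<tau> x \<in> trms L" for x
    using assms by (auto simp: substs_def subst_comp_def intro: subst_trm_in_trms)
  ultimately show ?thesis by (simp add: substs_def)
qed

lemma restrict_in_substs:
  assumes "finite V" "\<And>x. x \<in> V \<Longrightarrow> \<theta> x \<in> trms L"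
  shows "(\<lambda>x. if x \<in> V then \<theta> x else Var x) \<in> substs L"
proof -
  have "dom_subst (\<lambda>x. if x \<in> V then \<theta> x else Var x) \<subseteq> V"
    by (auto simp: dom_subst_def)
  with assms show ?thesis by (auto simp: substs_def intro: finite_subset)
qed

lemma override_in_substs:
  assumes "\<sigma> \<in> substs L" "\<tau> \<in> substs L"
  shows "(\<lambda>x. if x \<in> V then \<sigma> x else \<tau> x) \<in> substs L"
proof -
  have "dom_subst (\<lambda>x. if x \<in> V then \<sigma> x else \<tau> x) \<subseteq> dom_subst \<sigma> \<union> dom_subst \<tau>"
    by (auto simp: dom_subst_def)
  with assms show ?thesis by (auto simp: substs_def intro: finite_subset)
qed

lemma finite_vars_subst: "\<theta> \<in> substs L \<Longrightarrow> finite (vars_subst \<theta>)"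
  by (auto simp: substs_def vars_subst_def)

text \<open>Adding a strict bound \<open>k\<close> of \<open>V\<close> to every variable of
  \<open>c\<close> leads out of \<open>V\<close>, and subtracting \<open>k\<close> undoes it. Both
  renamings act on finitely many variables only, as membership in \<open>substs L\<close>
  demands.\<close>

lemma exists_fresh_variant:
  assumes "finite V"
  shows "\<exists>c'. fresh_variant L V c c'"
proof -
  let ?X = "vars_clause c"
  have "finite (V \<union> ?X)"
    using assms by simp
  then obtain k where k: "\<And>x. x \<in> V \<union> ?X \<Longrightarrow> x < k"
    by (meson finite_nat_set_iff_bounded)
  define \<sigma> :: "'a subst" where "\<sigma> = (\<lambda>x. if x \<in> ?X then Var (x + k) else Var x)"
  define \<tau> :: "'a subst" where "\<tau> = (\<lambda>x. if x \<in> (\<lambda>x. x + k) ` ?X then Var (x - k) else Var x)"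
  have "\<sigma> \<in> substs L" "\<tau> \<in> substs L"
    unfolding \<sigma>_def \<tau>_def by (rule restrict_in_substs; simp)+
  moreover have "subst_clause (subst_comp \<sigma> \<tau>) c = subst_clause Var c"
    by (rule subst_clause_cong) (simp add: subst_comp_def \<sigma>_def \<tau>_def)
  then have "subst_clause \<tau> (subst_clause \<sigma> c) = c"
    by (simp add: subst_clause_comp)
  ultimately have "clause_variant L (subst_clause \<sigma> c) c"
    unfolding clause_variant_def by metis
  moreover have "vars_clause (subst_clause \<sigma> c) \<inter> V = {}"
    using k by (force simp: vars_subst_clause \<sigma>_def)
  ultimately show ?thesis
    by (auto simp: fresh_variant_def)
qed

section \<open>The well-founded model\<close>

lemma mono_wf_operator: "mono (wf_operator L P)"
proof
  fix I J :: "('a, 'b) lit set"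
  assume "I \<subseteq> J"
  then have "unfounded L P I U \<Longrightarrow> unfounded L P J U" for U
    unfolding unfounded_def by blast
  with \<open>I \<subseteq> J\<close> show "wf_operator L P I \<subseteq> wf_operator L P J"
    unfolding wf_operator_def by blast
qed

lemma WF_unfold: "WF L P = wf_operator L P (WF L P)"
  unfolding WF_def by (rule lfp_unfold[OF mono_wf_operator])

lemma Pos_in_wf_operator:
  "Pos A \<in> wf_operator L P I \<longleftrightarrow> (\<exists>c\<in>ground_clauses L P. head c = A \<and> set (body c) \<subseteq> I)"
  by (auto simp: wf_operator_def)

lemma Neg_in_wf_operator: "Neg A \<in> wf_operator L P I \<longleftrightarrow> (\<exists>U. unfounded L P I U \<and> A \<in> U)"
  by (auto simp: wf_operator_def)

lemma WF_induct [consumes 1, case_names step]: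
  assumes "l \<in> WF L P" "\<And>l. l \<in> wf_operator L P (WF L P \<inter> {l. \<Phi> l}) \<Longrightarrow> \<Phi> l"
  shows "\<Phi> l"
  using assms unfolding WF_def by (rule lfp_induct_set[OF _ mono_wf_operator])

text \<open>There is no first atom of \<open>U\<close> to be derived: the body literals used were
  derived before, so none is an atom of \<open>U\<close>, and by compatibility none has its
  complement in \<open>I\<close>. \<open>I\<close> is kept general because
  \<open>WF_consistent\<close> applies this to a part of the model.\<close>

lemma unfounded_disjoint_WF:
  assumes U: "unfounded L P I U" and compat: "\<And>l. l \<in> I \<Longrightarrow> compl_lit l \<notin> WF L P"
    and "Pos A \<in> WF L P"
  shows "A \<notin> U"
proof -
  have compl: "compl_lit (compl_lit l) = l" for l :: "('a, 'b) lit"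
    by (cases l) auto
  have "\<forall>A. l = Pos A \<longrightarrow> A \<notin> U" if "l \<in> WF L P" for l
    using that
  proof (induction rule: WF_induct)
    case (step l)
    show ?case
    proof (intro allI impI notI)
      fix A assume "l = Pos A" "A \<in> U"
      with step obtain c where c: "c \<in> ground_clauses L P" "head c = A"
        and b: "\<And>l. l \<in> set (body c) \<Longrightarrow> l \<in> WF L P \<and> (\<forall>A. l = Pos A \<longrightarrow> A \<notin> U)"
        by (auto simp: Pos_in_wf_operator)
      with U \<open>A \<in> U\<close> obtain l' where "l' \<in> set (body c)" "compl_lit l' \<in> I"
        unfolding unfounded_def by metis
      with b compat[of "compl_lit l'"] show False
        by (simp add: compl)
    qed
  qed
  with assms(3) show ?thesis by blast
qed

lemma WF_consistent: "l \<in> WF L P \<Longrightarrow> compl_lit l \<notin> WF L P"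
proof (induction rule: WF_induct)
  case (step l)
  show ?case
  proof (cases l)
    case (Pos A)
    with step obtain c where c: "c \<in> ground_clauses L P" "head c = A"
      and b: "\<And>l. l \<in> set (body c) \<Longrightarrow> l \<in> WF L P \<and> compl_lit l \<notin> WF L P"
      by (auto simp: Pos_in_wf_operator)
    show ?thesis
    proof
      assume "compl_lit l \<in> WF L P"
      then have "Neg A \<in> wf_operator L P (WF L P)"
        using Pos WF_unfold by auto
      then obtain U where U: "unfounded L P (WF L P) U" "A \<in> U"
        by (auto simp: Neg_in_wf_operator)
      with b c obtain B where "B \<in> U" "Pos B \<in> set (body c)"
        unfolding unfounded_def by metis
      \<comment> \<open>All of \<open>U\<close> is false in the model, so the body atom
        \<open>B\<close> would be both true and false, which the induction hypothesis
        excludes.\<close>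
      moreover from U(1) \<open>B \<in> U\<close> have "Neg B \<in> wf_operator L P (WF L P)"
        by (auto simp: Neg_in_wf_operator)
      ultimately show False
        using b[of "Pos B"] WF_unfold by auto
    qed
  next
    case (Neg A)
    \<comment> \<open>\<open>U\<close> is unfounded relative to the literals already known to be
      consistent, and these satisfy the compatibility condition of
      \<open>unfounded_disjoint_WF\<close>.\<close>
    with step obtain U where U: "unfounded L P (WF L P \<inter> {l. compl_lit l \<notin> WF L P}) U" "A \<in> U"
      by (auto simp: Neg_in_wf_operator)
    with unfounded_disjoint_WF[OF U(1)] Neg show ?thesis by auto
  qed
qed

text \<open>\<open>val3_atom\<close> tests \<open>Pos A\<close> before \<open>Neg A\<close>.
  Consistency makes this order immaterial, so truth values reduce to membership, here and in the
  next lemma.\<close>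

lemma val3_lit_TT: "val3_lit (WF L P) l = TT \<longleftrightarrow> l \<in> WF L P"
  using WF_consistent[of l L P] by (cases l) (auto simp: val3_atom_def)

lemma val3_lit_FF: "val3_lit (WF L P) l = FF \<longleftrightarrow> compl_lit l \<in> WF L P"
  using WF_consistent[of "compl_lit l" L P] by (cases l) (auto simp: val3_atom_def)

lemma val3_query_TT: "val3_query I Q = TT \<longleftrightarrow> (\<forall>l\<in>set Q. val3_lit I l = TT)"
proof (induction Q)
  case (Cons l Q)
  then show ?case
    by (cases "val3_lit I l"; simp add: val3_query_def)
qed (simp add: val3_query_def)

lemma val3_query_FF: "val3_query I Q = FF \<longleftrightarrow> (\<exists>l\<in>set Q. val3_lit I l = FF)"
proof (induction Q)
  case (Cons l Q)
  then show ?case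
    by (cases "val3_lit I l"; simp add: val3_query_def)
qed (simp add: val3_query_def)

lemma kleene_not_TT: "kleene_not b = TT \<longleftrightarrow> b = FF"
  by (cases b) auto

lemma models3_Conj_WF:
  "models3 L (WF L P) (Conj Q) \<longleftrightarrow>
     (\<forall>\<theta>\<in>substs L. vars_query (subst_query \<theta> Q) = {} \<longrightarrow> set (subst_query \<theta> Q) \<subseteq> WF L P)"
  by (auto simp: val3_query_TT val3_lit_TT)

lemma models3_NotConj_WF:
  "models3 L (WF L P) (NotConj Q) \<longleftrightarrow>
     (\<forall>\<theta>\<in>substs L. vars_query (subst_query \<theta> Q) = {} \<longrightarrow>
        (\<exists>l\<in>set (subst_query \<theta> Q). compl_lit l \<in> WF L P))"
  by (simp add: val3_query_FF val3_lit_FF kleene_not_TT)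

section \<open>Soundness of main SLS-trees\<close>

text \<open>Grounds all variables at once and therefore lies outside \<open>substs L\<close>, whose
  members have finite domain. This avoids tracking which variables occur further down a branch;
  \<open>grounding_restrict\<close> returns to \<open>substs L\<close>.\<close>

definition grounding :: "('f, 'p) language \<Rightarrow> 'f subst \<Rightarrow> bool" where
  "grounding L \<eta> \<longleftrightarrow> (\<forall>x. \<eta> x \<in> trms L \<and> vars_trm (\<eta> x) = {})"

lemma exists_grounding:
  assumes "is_language L"
  shows "\<exists>\<eta>. grounding L \<eta>"
proof -
  obtain a where "(a, 0) \<in> funs L"
    using assms by (auto simp: is_language_def)
  then have "grounding L (\<lambda>_. Fun a [])"
    by (simp add: grounding_def trms_def)
  then show ?thesis by blast
qed

lemma grounding_restrict:
  "grounding L \<eta> \<Longrightarrow> finite V \<Longrightarrow> \<exists>\<theta>\<in>substs L. \<forall>x\<in>V. \<theta> x = \<eta> x"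
  by (rule bexI[OF _ restrict_in_substs[of V \<eta> L]]) (auto simp: grounding_def)

lemma grounding_extend:
  assumes "is_language L" "\<theta> \<in> substs L" "vars_query (subst_query \<theta> Q) = {}"
  shows "\<exists>\<eta>. grounding L \<eta> \<and> subst_query \<eta> Q = subst_query \<theta> Q"
proof -
  obtain \<eta> where \<eta>: "grounding L \<eta>"
    using exists_grounding[OF assms(1)] by blast
  define \<mu> where "\<mu> = (\<lambda>x. if x \<in> vars_query Q then \<theta> x else \<eta> x)"
  have "grounding L \<mu>"
    using \<eta> assms(2,3) by (auto simp: grounding_def \<mu>_def vars_subst_query substs_in_trms)
  moreover have "subst_query \<mu> Q = subst_query \<theta> Q"
    by (rule subst_query_cong) (simp add: \<mu>_def)
  ultimately show ?thesis by blast
qed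

lemma grounding_comp:
  assumes "\<And>x. \<theta> x \<in> trms L" "grounding L \<eta>"
  shows "grounding L (subst_comp \<theta> \<eta>)"
  using assms by (auto simp: grounding_def subst_comp_def vars_subst_trm intro!: subst_trm_in_trms)

lemma ground_clause_variant:
  assumes "c \<in> P" "clause_variant L c' c" "grounding L \<eta>"
  shows "subst_clause \<eta> c' \<in> ground_clauses L P"
proof -
  obtain \<sigma> where \<sigma>: "\<sigma> \<in> substs L" "c' = subst_clause \<sigma> c"
    using assms(2) by (auto simp: clause_variant_def)
  obtain \<tau> where \<tau>: "\<tau> \<in> substs L" "\<forall>x\<in>vars_clause c'. \<tau> x = \<eta> x"
    using grounding_restrict[OF assms(3)] finite_vars_clause by metis
  then have "subst_clause \<eta> c' = subst_clause \<tau> c'"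
    by (intro subst_clause_cong) simp
  also have "\<dots> = subst_clause (subst_comp \<sigma> \<tau>) c"
    by (simp add: \<sigma> subst_clause_comp)
  finally have "subst_clause \<eta> c' = subst_clause (subst_comp \<sigma> \<tau>) c" .
  moreover have "vars_clause (subst_clause \<eta> c') = {}"
    using assms(3) by (auto simp: vars_subst_clause grounding_def)
  ultimately show ?thesis
    using assms(1) subst_comp_in_substs[OF \<sigma>(1) \<tau>(1)] unfolding ground_clauses_def
    by (metis (mono_tags, lifting) mem_Collect_eq)
qed

lemma set_take_nth_drop:
  "i < length N \<Longrightarrow> set N = insert (N ! i) (set (take i N) \<union> set (drop (Suc i) N))"
  by (metis Un_insert_right id_take_nth_drop list.simps(15) set_append)

lemma clause_variant_in_clauses:
  "P \<subseteq> clauses L \<Longrightarrow> c \<in> P \<Longrightarrow> clause_variant L c' c \<Longrightarrow> c' \<in> clauses L"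
  by (auto simp: clause_variant_def intro!: subst_clause_in_clauses dest: substs_in_trms)

lemma resolvent_in_queries:
  assumes "N \<in> queries L" "c \<in> clauses L" "\<theta> \<in> substs L"
  shows "resolvent N i c \<theta> \<in> queries L"
  unfolding resolvent_def
  by (rule subst_query_in_queries)
    (use assms in \<open>auto simp: queries_def clauses_def substs_in_trms dest: in_set_takeD in_set_dropD\<close>)

lemma removed_in_queries: "N \<in> queries L \<Longrightarrow> take i N @ drop (Suc i) N \<in> queries L"
  by (auto simp: queries_def dest: in_set_takeD in_set_dropD)

lemma mgu_in_substs: "mgu L \<theta> A B \<Longrightarrow> \<theta> \<in> substs L"
  by (simp add: mgu_def unifier_def)

lemma fails_sound_grounding:
  assumes "sls_resolution L P S" "A \<in> atoms L" "fails S [Pos A]" "grounding L \<eta>"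
  shows "Neg (subst_atom \<eta> A) \<in> WF L P"
proof -
  obtain \<theta> where \<theta>: "\<theta> \<in> substs L" "\<forall>x\<in>vars_query [Pos A]. \<theta> x = \<eta> x"
    using grounding_restrict[OF assms(4)] finite_vars_query by metis
  then have eq: "subst_query \<theta> [Pos A] = subst_query \<eta> [Pos A]"
    by (intro subst_query_cong) simp
  have "vars_query (subst_query \<eta> [Pos A]) = {}"
    using assms(4) by (auto simp: vars_subst_query grounding_def)
  moreover have "[Pos A] \<in> queries L"
    using assms(2) by (simp add: queries_def)
  then have "models3 L (WF L P) (NotConj [Pos A])"
    using assms(1,3) by (simp add: sls_resolution.fails_sound del: models3.simps)
  ultimately show ?thesis
    using \<theta>(1) eq unfolding models3_NotConj_WF by (auto simp: subst_query_def)
qed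

text \<open>Going up from the empty query, each selected literal becomes true: a positive one is the
  head of a ground clause instance with true body, a negative one is true by soundness of failure.
  Groundness is claimed along with it because it rests on the mgus lying in \<open>substs L\<close>,
  which only \<open>sls_tree_at\<close> provides.\<close>

lemma branch_subst_sound:
  assumes "sls_resolution L P S" "P \<subseteq> clauses L" "is_selection_rule \<R>" "grounding L \<eta>"
    and "branch_subst T \<rho>" "sls_tree_at L P S \<R> h N T" "N \<in> queries L"
  shows "grounding L (subst_comp \<rho> \<eta>) \<and> set (subst_query (subst_comp \<rho> \<eta>) N) \<subseteq> WF L P"
  using assms(5-7)
proof (induction arbitrary: h N rule: branch_subst.induct)
  case 1
  from 1(1) have "N = []" by cases auto
  with assms(4) show ?case by (simp add: subst_comp_def subst_query_def)
next
  case (2 kids c c' \<theta> t \<rho> M)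
  from 2(4) obtain i A where N: "N \<noteq> []" "i = \<R> h N" "N ! i = Pos A"
    and kids: "\<And>c. kids c \<noteq> None \<Longrightarrow> c \<in> P"
      "\<And>c c' \<theta> t. kids c = Some (c', \<theta>, t) \<Longrightarrow>
        fresh_variant L (used_vars h N) c c' \<and> mgu L \<theta> A (head c') \<and>
        sls_tree_at L P S \<R> (h @ [(N, i, Some (c', \<theta>))]) (resolvent N i c' \<theta>) t"
    by cases auto
  have c: "c \<in> P" "fresh_variant L (used_vars h N) c c'" and mgu: "mgu L \<theta> A (head c')"
    and t: "sls_tree_at L P S \<R> (h @ [(N, i, Some (c', \<theta>))]) (resolvent N i c' \<theta>) t"
    using kids(1)[of c] kids(2)[of c c' \<theta> t] 2(1) by auto
  have i: "i < length N"
    using N assms(3) by (simp add: is_selection_rule_def)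
  have var: "clause_variant L c' c"
    using c(2) by (simp add: fresh_variant_def)
  have c': "c' \<in> clauses L"
    using clause_variant_in_clauses[OF assms(2) c(1) var] .
  define \<alpha> where "\<alpha> = subst_comp \<rho> \<eta>"
  have "grounding L \<alpha>" and WF: "set (subst_query \<alpha> (resolvent N i c' \<theta>)) \<subseteq> WF L P"
    using 2(3)[OF t] resolvent_in_queries[OF 2(5) c' mgu_in_substs[OF mgu]] by (auto simp: \<alpha>_def)
  \<comment> \<open>The instantiation of the parent node: first the mgu of the step, then the
    instantiation of the child.\<close>
  define \<beta> where "\<beta> = subst_comp \<theta> \<alpha>"
  have \<beta>: "grounding L \<beta>"
    unfolding \<beta>_def using mgu_in_substs[OF mgu] \<open>grounding L \<alpha>\<close>
    by (intro grounding_comp) (auto dest: substs_in_trms)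
  have eq: "subst_comp (subst_comp \<theta> \<rho>) \<eta> = \<beta>"
    by (simp add: fun_eq_iff \<beta>_def \<alpha>_def subst_comp_def subst_trm_comp[unfolded subst_comp_def])
  have WF': "set (subst_query \<beta> (take i N @ body c' @ drop (Suc i) N)) \<subseteq> WF L P"
    using WF by (simp add: resolvent_def \<beta>_def subst_query_comp)
  have "subst_clause \<beta> c' \<in> ground_clauses L P"
    using c(1) var \<beta> by (rule ground_clause_variant)
  moreover have "set (body (subst_clause \<beta> c')) \<subseteq> WF L P"
    using WF' by (auto simp: subst_clause_def subst_query_def)
  \<comment> \<open>The model is a fixpoint, so the head of this clause instance is true; the mgu
    identifies it with the selected atom.\<close>
  ultimately have "Pos (head (subst_clause \<beta> c')) \<in> wf_operator L P (WF L P)"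
    by (auto simp: Pos_in_wf_operator)
  moreover have "subst_atom \<beta> A = subst_atom \<beta> (head c')"
    using mgu by (simp add: \<beta>_def mgu_def unifier_def subst_atom_comp)
  ultimately have "subst_lit \<beta> (N ! i) \<in> WF L P"
    using WF_unfold N(3) by (auto simp: subst_clause_def)
  then have "set (subst_query \<beta> N) \<subseteq> WF L P"
    using WF' by (auto simp: subst_query_def set_take_nth_drop[OF i])
  with \<beta> eq show ?case by simp
next
  case (3 t \<rho> M)
  from 3(3) obtain i A where N: "N \<noteq> []" "i = \<R> h N" "N ! i = Neg A"
    and fails: "fails S [Pos A]"
    and t: "sls_tree_at L P S \<R> (h @ [(N, i, None)]) (take i N @ drop (Suc i) N) t"
    by cases auto
  have i: "i < length N"
    using N assms(3) by (simp add: is_selection_rule_def)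
  define \<alpha> where "\<alpha> = subst_comp \<rho> \<eta>"
  have \<alpha>: "grounding L \<alpha>" and WF: "set (subst_query \<alpha> (take i N @ drop (Suc i) N)) \<subseteq> WF L P"
    using 3(2)[OF t removed_in_queries[OF 3(4)]] by (auto simp: \<alpha>_def)
  have "A \<in> atoms L"
    using 3(4) N(3) nth_mem[OF i] by (force simp: queries_def)
  then have "subst_lit \<alpha> (N ! i) \<in> WF L P"
    using fails_sound_grounding[OF assms(1) _ fails \<alpha>] N(3) by simp
  with WF \<alpha> show ?case
    by (auto simp: \<alpha>_def subst_query_def set_take_nth_drop[OF i])
qed

section \<open>Finite support of literals that are not false\<close>

text \<open>Finite proof trees with their size; \<open>\<Phi>\<close> decides which negative leaves
  are accepted. A negative leaf counts 1, so that removing a negative literal also lowers the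
  measure used for lifting. The clauses may be non-ground, as they will be after
  abstraction.\<close>

inductive supported ::
    "('f, 'p) clause set \<Rightarrow> (('f, 'p) atom \<Rightarrow> bool) \<Rightarrow> ('f, 'p) lit \<Rightarrow> nat \<Rightarrow> bool"
  for C \<Phi> where
  Neg: "\<Phi> B \<Longrightarrow> supported C \<Phi> (Neg B) (Suc 0)"
| Pos: "c \<in> C \<Longrightarrow> list_all2 (supported C \<Phi>) (body c) ms \<Longrightarrow>
    supported C \<Phi> (Pos (head c)) (Suc (sum_list ms))"

lemma list_all2_exists: "\<forall>x\<in>set xs. \<exists>y. R x y \<Longrightarrow> \<exists>ys. list_all2 R xs ys"
  by (induction xs) (auto intro: list_all2_Cons1[THEN iffD2])

text \<open>The ground atoms without finite support form an unfounded set.\<close>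

lemma nonfalse_supported:
  assumes "P \<subseteq> clauses L" "A \<in> HB L" "Neg A \<notin> WF L P"
  shows "\<exists>n. supported (ground_clauses L P) (\<lambda>B. vars_atom B = {} \<and> Pos B \<notin> WF L P) (Pos A) n"
proof (rule ccontr)
  let ?supp = "supported (ground_clauses L P) (\<lambda>B. vars_atom B = {} \<and> Pos B \<notin> WF L P)"
  define U where "U = {A \<in> HB L. \<nexists>n. ?supp (Pos A) n}"
  assume "\<nexists>n. ?supp (Pos A) n"
  then have "A \<in> U"
    using assms(2) by (simp add: U_def)
  have "unfounded L P (WF L P) U"
    unfolding unfounded_def
  proof (intro conjI ballI impI)
    show "U \<subseteq> HB L" by (auto simp: U_def)
    fix c assume c: "c \<in> ground_clauses L P" "head c \<in> U"
    from c(1) assms(1) have "c \<in> clauses L" "vars_clause c = {}"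
      by (auto simp: ground_clauses_def intro!: subst_clause_in_clauses dest: substs_in_trms)
    then have HB: "atom_of l \<in> HB L" if "l \<in> set (body c)" for l
      using that by (auto simp: clauses_def queries_def HB_def vars_clause_def vars_query_def)
    show "(\<exists>l\<in>set (body c). compl_lit l \<in> WF L P) \<or> (\<exists>B\<in>U. Pos B \<in> set (body c))"
    proof (rule ccontr)
      assume *: "\<not> ?thesis"
      \<comment> \<open>A body atom outside \<open>U\<close> has a proof tree, and a negative
        literal that is not false is a leaf; together they would support the head.\<close>
      have "\<exists>n. ?supp l n" if l: "l \<in> set (body c)" for l
      proof (cases l)
        case (Pos B)
        with * HB[OF l] l show ?thesis by (auto simp: U_def)
      next
        case (Neg B)
        with * HB[OF l] l have "vars_atom B = {} \<and> Pos B \<notin> WF L P"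
          by (force simp: HB_def)
        with Neg show ?thesis by (auto intro: supported.Neg)
      qed
      then obtain ms where "list_all2 ?supp (body c) ms"
        using list_all2_exists[of "body c" ?supp] by auto
      with c(1) have "?supp (Pos (head c)) (Suc (sum_list ms))"
        by (rule supported.Pos)
      with c(2) show False by (auto simp: U_def)
    qed
  qed
  with \<open>A \<in> U\<close> have "Neg A \<in> wf_operator L P (WF L P)"
    by (auto simp: Neg_in_wf_operator)
  with assms(3) WF_unfold show False by blast
qed

section \<open>Replacing separating ground terms by variables\<close>

fun map_args_atom :: "('f trm \<Rightarrow> 'f trm) \<Rightarrow> ('f, 'p) atom \<Rightarrow> ('f, 'p) atom" where
  "map_args_atom u (Atom p ts) = Atom p (map u ts)"

fun map_args :: "('f trm \<Rightarrow> 'f trm) \<Rightarrow> ('f, 'p) lit \<Rightarrow> ('f, 'p) lit" where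
  "map_args u (Pos A) = Pos (map_args_atom u A)"
| "map_args u (Neg A) = Neg (map_args_atom u A)"

fun args :: "('f, 'p) atom \<Rightarrow> 'f trm set" where
  "args (Atom p ts) = set ts"

text \<open>The counterpart of \<open>ground_clauses\<close> for proofs in which ground terms have
  been turned back into variables.\<close>

definition instances ::
    "('f, 'p) language \<Rightarrow> ('f, 'p) clause set \<Rightarrow> ('f, 'p) clause set" where
  "instances L P = {subst_clause \<sigma> c | \<sigma> c. c \<in> P \<and> \<sigma> \<in> substs L}"

definition ground_by :: "nat set \<Rightarrow> (nat \<Rightarrow> 'f trm) \<Rightarrow> 'f subst" where
  "ground_by V g x = (if x \<in> V then g x else Var x)"

text \<open>
  The ground terms \<open>g x\<close> are to play the role of the variables \<open>x \<in> V\<close>: the clauses of \<open>P\<close>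
  cannot inspect them, and no non-variable term in \<open>T\<close> becomes equal to one of them.
\<close>

locale separation =
  fixes L :: "('f, 'p) language" and P :: "('f, 'p) clause set"
    and V :: "nat set" and T :: "'f trm set" and g :: "nat \<Rightarrow> 'f trm"
  assumes finite_V: "finite V"
    and g_in_trms: "x \<in> V \<Longrightarrow> g x \<in> trms L"
    and g_ground: "x \<in> V \<Longrightarrow> vars_trm (g x) = {}"
    and g_root: "x \<in> V \<Longrightarrow> \<exists>f ts. g x = Fun f ts \<and> (\<forall>c\<in>P. (f, length ts) \<notin> funs_clause c)"
    and g_inj: "inj_on g V"
    and T_args: "Fun h ts \<in> T \<Longrightarrow> set ts \<subseteq> T"
    and T_separated: "Fun h ts \<in> T \<Longrightarrow> subst_trm (ground_by V g) (Fun h ts) \<notin> g ` V"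
begin

abbreviation "\<gamma> \<equiv> ground_by V g"

text \<open>Outermost occurrences are replaced: the test precedes the descent because one
  \<open>g x\<close> may contain another one as a subterm, as happens for the towers below.\<close>

fun abstr :: "'f trm \<Rightarrow> 'f trm" where
  "abstr (Var x) = Var x"
| "abstr (Fun f ts) =
    (if Fun f ts \<in> g ` V then Var (inv_into V g (Fun f ts)) else Fun f (map abstr ts))"

lemma \<gamma>_in_substs: "\<gamma> \<in> substs L"
  using restrict_in_substs[of V g L] finite_V g_in_trms by (simp add: ground_by_def[abs_def])

lemma subst_abstr: "vars_trm t = {} \<Longrightarrow> subst_trm \<gamma> (abstr t) = t"
  by (induction t) (auto simp: ground_by_def f_inv_into_f inv_into_into intro!: map_idI)

text \<open>Only variables of \<open>t\<close> can have become terms \<open>g x\<close>: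
  \<open>T_separated\<close> excludes this for the compound subterms, which stay in \<open>T\<close>
  by \<open>T_args\<close>, and injectivity of \<open>g\<close> recovers the variable.\<close>

lemma abstr_subst: "t \<in> T \<Longrightarrow> vars_trm t \<subseteq> V \<Longrightarrow> abstr (subst_trm \<gamma> t) = t"
proof (induction t)
  case (Var x)
  then have "x \<in> V" by simp
  moreover from this obtain f ts where "g x = Fun f ts" using g_root by blast
  ultimately show ?case
    using g_inj by (simp add: ground_by_def) (metis image_eqI inv_into_f_f)
next
  case (Fun h ts)
  then have "\<forall>t\<in>set ts. abstr (subst_trm \<gamma> t) = t"
    using T_args by fastforce
  with T_separated[OF Fun.prems(1)] show ?case
    by (auto intro: map_idI)
qed

text \<open>No symbol of the clause is the root of some \<open>g x\<close>, so every replaced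
  occurrence lies inside a substituted term \<open>\<sigma> x\<close>. This is the sense in which
  clauses cannot inspect the separating terms.\<close>

lemma abstr_subst_trm_fresh:
  assumes "c \<in> P" "funs_trm t \<subseteq> funs_clause c"
  shows "abstr (subst_trm \<sigma> t) = subst_trm (\<lambda>x. abstr (\<sigma> x)) t"
  using assms(2)
proof (induction t)
  case (Fun h ts)
  have "Fun h (map (subst_trm \<sigma>) ts) \<notin> g ` V"
  proof
    assume "Fun h (map (subst_trm \<sigma>) ts) \<in> g ` V"
    then obtain x where "x \<in> V" "g x = Fun h (map (subst_trm \<sigma>) ts)" by auto
    with g_root[of x] assms(1) Fun.prems show False by auto
  qed
  with Fun show ?case by (auto simp: UN_subset_iff)
qed simp

lemma map_args_atom_subst_fresh:
  "c \<in> P \<Longrightarrow> funs_atom A \<subseteq> funs_clause c \<Longrightarrow>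
    map_args_atom abstr (subst_atom \<sigma> A) = subst_atom (\<lambda>x. abstr (\<sigma> x)) A"
  by (cases A) (auto simp: UN_subset_iff intro!: abstr_subst_trm_fresh)

lemma map_args_subst_fresh:
  "c \<in> P \<Longrightarrow> funs_atom (atom_of l) \<subseteq> funs_clause c \<Longrightarrow>
    map_args abstr (subst_lit \<sigma> l) = subst_lit (\<lambda>x. abstr (\<sigma> x)) l"
  by (cases l) (simp_all add: map_args_atom_subst_fresh)

lemma abstr_in_trms: "t \<in> trms L \<Longrightarrow> abstr t \<in> trms L"
  by (induction t) (auto simp: trms_def)

lemma abstr_comp_in_substs:
  assumes "\<sigma> \<in> substs L"
  shows "(\<lambda>x. abstr (\<sigma> x)) \<in> substs L"
proof -
  have "dom_subst (\<lambda>x. abstr (\<sigma> x)) \<subseteq> dom_subst \<sigma>"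
    by (auto simp: dom_subst_def)
  with assms show ?thesis
    by (auto simp: substs_def abstr_in_trms intro: finite_subset)
qed

lemma abstr_ground_clause:
  assumes "c \<in> ground_clauses L P"
  shows "\<exists>d\<in>instances L P. head d = map_args_atom abstr (head c) \<and>
    body d = map (map_args abstr) (body c)"
proof -
  obtain \<sigma> b where b: "c = subst_clause \<sigma> b" "b \<in> P" "\<sigma> \<in> substs L"
    using assms by (auto simp: ground_clauses_def)
  show ?thesis
  proof
    show "subst_clause (\<lambda>x. abstr (\<sigma> x)) b \<in> instances L P"
      using b abstr_comp_in_substs by (auto simp: instances_def)
    have "funs_atom (atom_of l) \<subseteq> funs_clause b" if "l \<in> set (body b)" for l
      using that by (auto simp: funs_clause_def funs_query_def)
    then show "head (subst_clause (\<lambda>x. abstr (\<sigma> x)) b) = map_args_atom abstr (head c) \<and>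
        body (subst_clause (\<lambda>x. abstr (\<sigma> x)) b) = map (map_args abstr) (body c)"
      using b(2) by (auto simp: b(1) subst_clause_def subst_query_def map_args_subst_fresh
          intro!: map_args_atom_subst_fresh[symmetric]) (auto simp: funs_clause_def)
  qed
qed

lemma subst_map_args_abstr: "vars_atom A = {} \<Longrightarrow> subst_atom \<gamma> (map_args_atom abstr A) = A"
  by (cases A) (auto simp: subst_abstr intro!: map_idI)

text \<open>Abstraction turns each ground clause instance into another instance of the same program
  clause, hence keeps the shape and size of the tree. Applying \<open>\<gamma>\<close> to an
  abstracted negative leaf gives back the original ground atom, so the leaf condition
  survives.\<close>

lemma supported_abstr:
  "supported (ground_clauses L P) (\<lambda>B. vars_atom B = {} \<and> B \<notin> I) l n \<Longrightarrow>
    supported (instances L P) (\<lambda>B. vars_atom (subst_atom \<gamma> B) = {} \<and> subst_atom \<gamma> B \<notin> I)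
      (map_args abstr l) n"
proof (induction rule: supported.induct)
  case (Neg B)
  then show ?case by (auto simp: subst_map_args_abstr intro: supported.Neg)
next
  case (Pos c ms)
  then obtain d where d: "d \<in> instances L P" "head d = map_args_atom abstr (head c)"
    "body d = map (map_args abstr) (body c)"
    using abstr_ground_clause by blast
  have "list_all2 (supported (instances L P)
      (\<lambda>B. vars_atom (subst_atom \<gamma> B) = {} \<and> subst_atom \<gamma> B \<notin> I)) (body d) ms"
    unfolding d(3) list_all2_map1 using Pos(2) by (rule list_all2_mono) blast
  from supported.Pos[OF d(1) this] d(2) show ?case by simp
qed

lemma map_args_abstr_subst:
  assumes "args (atom_of l) \<subseteq> T" "vars_atom (atom_of l) \<subseteq> V"
  shows "map_args abstr (subst_lit \<gamma> l) = l"
proof -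
  have "map_args_atom abstr (subst_atom \<gamma> (atom_of l)) = atom_of l"
    using assms by (cases "atom_of l") (auto simp: UN_subset_iff abstr_subst intro!: map_idI)
  then show ?thesis by (cases l) auto
qed

lemma nonfalse_query_supported:
  assumes "P \<subseteq> clauses L" "Q \<in> queries L" "vars_query Q \<subseteq> V"
    and "\<And>l. l \<in> set Q \<Longrightarrow> args (atom_of l) \<subseteq> T"
    and "\<And>l. l \<in> set (subst_query \<gamma> Q) \<Longrightarrow> compl_lit l \<notin> WF L P"
  shows "\<exists>ns. list_all2 (supported (instances L P)
    (\<lambda>B. vars_atom (subst_atom \<gamma> B) = {} \<and> Pos (subst_atom \<gamma> B) \<notin> WF L P)) Q ns"
proof (intro list_all2_exists ballI)
  fix l assume l: "l \<in> set Q"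
  let ?supp = "supported (ground_clauses L P) (\<lambda>B. vars_atom B = {} \<and> Pos B \<notin> WF L P)"
  have "vars_atom (atom_of l) \<subseteq> V"
    using l assms(3) by (auto simp: vars_query_def)
  then have ground: "vars_atom (subst_atom \<gamma> (atom_of l)) = {}"
    using g_ground by (auto simp: vars_subst_atom ground_by_def subset_iff)
  moreover have "subst_atom \<gamma> (atom_of l) \<in> atoms L"
    using l assms(2) \<gamma>_in_substs by (auto simp: queries_def intro!: subst_atom_in_atoms substs_in_trms)
  ultimately have HB: "subst_atom \<gamma> (atom_of l) \<in> HB L"
    by (simp add: HB_def)
  have nonfalse: "compl_lit (subst_lit \<gamma> l) \<notin> WF L P"
    using l by (intro assms(5)) (simp add: subst_query_def)
  have "\<exists>n. ?supp (subst_lit \<gamma> l) n"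
  proof (cases l)
    case (Pos A)
    with HB nonfalse nonfalse_supported[OF assms(1)] show ?thesis by auto
  next
    case (Neg A)
    with ground nonfalse show ?thesis by (auto intro: supported.Neg)
  qed
  then obtain n where "?supp (subst_lit \<gamma> l) n" ..
  \<comment> \<open>Here \<open>I\<close> is the set of true atoms, and abstracting the grounded
    literal restores \<open>l\<close> itself.\<close>
  from supported_abstr[of "{B. Pos B \<in> WF L P}", simplified, OF this]
  show "\<exists>n. supported (instances L P)
    (\<lambda>B. vars_atom (subst_atom \<gamma> B) = {} \<and> Pos (subst_atom \<gamma> B) \<notin> WF L P) l n"
    using map_args_abstr_subst[OF assms(4)[OF l] \<open>vars_atom (atom_of l) \<subseteq> V\<close>] by auto
qed

end

section \<open>Lifting\<close>

text \<open>Since the variant is standardized apart, a substitution on \<open>W\<close> and one on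
  the variables of \<open>c'\<close> can be glued together. Agreement on all of \<open>W\<close>,
  not just on \<open>A\<close>, preserves the rest of the node and the history.\<close>

lemma fresh_variant_unifier:
  assumes "fresh_variant L W c c'" "vars_atom A \<subseteq> W" "\<eta> \<in> substs L" "\<sigma> \<in> substs L"
    and "subst_atom \<eta> A = head (subst_clause \<sigma> c)"
  shows "\<exists>\<mu>. unifier L \<mu> A (head c') \<and> (\<forall>x\<in>W. \<mu> x = \<eta> x) \<and>
    subst_clause \<mu> c' = subst_clause \<sigma> c"
proof -
  obtain \<tau> where \<tau>: "\<tau> \<in> substs L" "c = subst_clause \<tau> c'"
    using assms(1) by (auto simp: fresh_variant_def clause_variant_def)
  have disj: "vars_clause c' \<inter> W = {}"
    using assms(1) by (simp add: fresh_variant_def)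
  \<comment> \<open>Outside \<open>W\<close>, \<open>\<tau>\<close> first renames the variant back
    to \<open>c\<close>, which \<open>\<sigma>\<close> then instantiates.\<close>
  define \<mu> where "\<mu> = (\<lambda>x. if x \<in> W then \<eta> x else subst_comp \<tau> \<sigma> x)"
  have "\<mu> \<in> substs L"
    unfolding \<mu>_def using assms(3,4) \<tau>(1) by (intro override_in_substs subst_comp_in_substs)
  have c': "subst_clause \<mu> c' = subst_clause (subst_comp \<tau> \<sigma>) c'"
    using disj by (intro subst_clause_cong) (auto simp: \<mu>_def)
  then have "subst_clause \<mu> c' = subst_clause \<sigma> c"
    by (simp add: subst_clause_comp \<tau>(2))
  moreover have "subst_atom \<mu> A = subst_atom \<eta> A"
    using assms(2) by (intro subst_atom_cong) (auto simp: \<mu>_def)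
  then have "subst_atom \<mu> A = subst_atom \<mu> (head c')"
    using assms(5) calculation by (auto simp: subst_clause_def)
  ultimately show ?thesis
    using \<open>\<mu> \<in> substs L\<close> by (auto simp: unifier_def \<mu>_def)
qed

lemma subtrees_trans: "t \<in> subtrees u \<Longrightarrow> u \<in> subtrees T \<Longrightarrow> t \<in> subtrees T"
  by (induction rule: subtrees.induct) (auto intro: subtrees.intros)

lemma non_diverging_subtree: "non_diverging T \<Longrightarrow> t \<in> subtrees T \<Longrightarrow> non_diverging t"
  unfolding non_diverging_def using subtrees_trans by blast

text \<open>The answer is a variant of \<open>[Pos A]\<close>, so every ground instance of
  \<open>A\<close> is a ground instance of the answer, which is sound.\<close>

lemma succeeds_mg_ground_instance:
  assumes "sls_resolution L P S" "A \<in> atoms L" "succeeds_mg L S [Pos A]"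
    and "\<theta> \<in> substs L" "vars_atom (subst_atom \<theta> A) = {}"
  shows "Pos (subst_atom \<theta> A) \<in> WF L P"
proof -
  obtain R \<tau> where R: "answer S [Pos A] R" "\<tau> \<in> substs L" "[Pos A] = subst_query \<tau> R"
    using assms(3) unfolding succeeds_mg_def query_variant_def by blast
  have "[Pos A] \<in> queries L"
    using assms(2) by (simp add: queries_def)
  then have "models3 L (WF L P) (Conj R)"
    using assms(1) R(1) by (simp add: sls_resolution.answer_sound del: models3.simps)
  moreover have "subst_query (subst_comp \<tau> \<theta>) R = [Pos (subst_atom \<theta> A)]"
    by (simp add: subst_query_comp flip: R(3)) (simp add: subst_query_def)
  moreover have "vars_query [Pos (subst_atom \<theta> A)] = {}"
    using assms(5) by (simp add: vars_query_def)
  ultimately show ?thesis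
    using subst_comp_in_substs[OF R(2) assms(4)] unfolding models3_Conj_WF
    by (metis list.set_intros(1) subsetD)
qed

text \<open>Induction on the total size of the proof trees for the instantiated node. Agreement is
  claimed on all used variables, since those introduced by an mgu may have left the current query
  but still occur in the composed answer.\<close>

lemma lifting:
  assumes sls: "sls_resolution L P S" and P: "P \<subseteq> clauses L" and \<R>: "is_selection_rule \<R>"
    and \<gamma>: "\<gamma> \<in> substs L"
  defines "supp \<equiv> supported (instances L P)
    (\<lambda>B. vars_atom (subst_atom \<gamma> B) = {} \<and> Pos (subst_atom \<gamma> B) \<notin> WF L P)"
  assumes "sls_tree_at L P S \<R> h N T" "non_diverging T" "N \<in> queries L" "finite (used_vars h N)"
    and "\<eta> \<in> substs L" "list_all2 supp (subst_query \<eta> N) ns"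
  shows "\<exists>\<rho> \<xi>. branch_subst T \<rho> \<and> \<xi> \<in> substs L \<and>
    (\<forall>x\<in>used_vars h N. \<eta> x = subst_trm \<xi> (\<rho> x))"
  using assms(6-)
proof (induction "sum_list ns" arbitrary: h N T \<eta> ns rule: less_induct)
  case less
  note tree = less.prems(1) and nd = less.prems(2) and N = less.prems(3) and fin = less.prems(4)
    and \<eta> = less.prems(5) and ns = less.prems(6)
  show ?case
  proof (cases "N = []")
    case True
    with tree have "T = Success" by cases auto
    then have "branch_subst T Var"
      by (simp add: branch_subst.intros)
    with \<eta> show ?thesis
      by (metis subst_trm.simps(1))
  next
    case False
    define i where "i = \<R> h N"
    have i: "i < length N"
      using False \<R> by (simp add: i_def is_selection_rule_def)
    have len: "length ns = length N"
      using list_all2_lengthD[OF ns] by (simp add: subst_query_def)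
    have supp_i: "supp (subst_lit \<eta> (N ! i)) (ns ! i)"
      using list_all2_nthD[OF ns, of i] i by (simp add: subst_query_def)
    have sum: "sum_list ns = sum_list (take i ns) + ns ! i + sum_list (drop (Suc i) ns)"
      using arg_cong[OF id_take_nth_drop[of i ns], of sum_list] i len by simp
    have rest: "list_all2 supp (subst_query \<eta> (take i N)) (take i ns)"
        "list_all2 supp (subst_query \<eta> (drop (Suc i) N)) (drop (Suc i) ns)"
      using list_all2_takeI[OF ns, of i] list_all2_dropI[OF ns, of "Suc i"]
      by (simp_all add: subst_query_def take_map drop_map)
    have atoms: "atom_of (N ! i) \<in> atoms L"
      using N nth_mem[OF i] by (auto simp: queries_def)
    have vars: "vars_atom (atom_of (N ! i)) \<subseteq> used_vars h N"
      using nth_mem[OF i] by (auto simp: used_vars_def vars_query_def)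
    show ?thesis
    proof (cases "N ! i")
      case (Pos A)
      from supp_i obtain d ms where d: "d \<in> instances L P" "subst_atom \<eta> A = head d"
        "ns ! i = Suc (sum_list ms)" "list_all2 supp (body d) ms"
        unfolding supp_def by cases (auto simp: Pos)
      then obtain c \<sigma> where c: "c \<in> P" "\<sigma> \<in> substs L" "d = subst_clause \<sigma> c"
        by (auto simp: instances_def)
      have A: "vars_atom A \<subseteq> used_vars h N"
        using vars Pos by simp
      have unif: "\<exists>\<mu>. unifier L \<mu> A (head c') \<and> (\<forall>x\<in>used_vars h N. \<mu> x = \<eta> x) \<and>
          subst_clause \<mu> c' = d" if "fresh_variant L (used_vars h N) c c'" for c'
        using fresh_variant_unifier[OF that A \<eta> c(2)] d(2) c(3) by simp
      have appl: "applicable L (used_vars h N) A c"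
        using exists_fresh_variant[OF fin] unif by (force simp: applicable_def)
      \<comment> \<open>The last clause of the proof tree is applicable, so the node cannot be a
        failed leaf.\<close>
      from tree have "\<exists>kids. T = Resolve N kids \<and>
        (\<forall>c. kids c \<noteq> None \<longleftrightarrow> c \<in> P \<and> applicable L (used_vars h N) A c) \<and>
        (\<forall>c c' \<theta> t. kids c = Some (c', \<theta>, t) \<longrightarrow>
          fresh_variant L (used_vars h N) c c' \<and> mgu L \<theta> A (head c') \<and>
          sls_tree_at L P S \<R> (h @ [(N, i, Some (c', \<theta>))]) (resolvent N i c' \<theta>) t)"
      proof cases
        case (pos_failed A')
        with Pos c(1) appl show ?thesis by (simp add: i_def)
      next
        case (pos i' A' kids)
        then have "A' = A" "i' = i" using Pos by (simp_all add: i_def)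
        with pos show ?thesis by blast
      qed (use Pos False in \<open>simp_all add: i_def\<close>)
      then obtain kids where T: "T = Resolve N kids"
        and kids: "\<forall>c. kids c \<noteq> None \<longleftrightarrow> c \<in> P \<and> applicable L (used_vars h N) A c"
        "\<forall>c c' \<theta> t. kids c = Some (c', \<theta>, t) \<longrightarrow>
          fresh_variant L (used_vars h N) c c' \<and> mgu L \<theta> A (head c') \<and>
          sls_tree_at L P S \<R> (h @ [(N, i, Some (c', \<theta>))]) (resolvent N i c' \<theta>) t"
        by blast
      from kids(1) c(1) appl obtain c' \<theta> t where kid: "kids c = Some (c', \<theta>, t)"
        by (metis not_None_eq prod_cases3)
      with kids(2) have fresh: "fresh_variant L (used_vars h N) c c'" and mgu: "mgu L \<theta> A (head c')"
        and t: "sls_tree_at L P S \<R> (h @ [(N, i, Some (c', \<theta>))]) (resolvent N i c' \<theta>) t"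
        by auto
      obtain \<mu> where \<mu>: "unifier L \<mu> A (head c')" "\<forall>x\<in>used_vars h N. \<mu> x = \<eta> x"
        "subst_clause \<mu> c' = d"
        using unif[OF fresh] by blast
      \<comment> \<open>The mgu is chosen by the tree, \<open>\<mu>\<close> comes from the proof;
        \<open>\<delta>\<close> is the instantiation left for the child.\<close>
      with mgu obtain \<delta> where \<delta>: "\<delta> \<in> substs L" "\<mu> = subst_comp \<theta> \<delta>"
        by (auto simp: mgu_def)
      have \<theta>: "\<theta> \<in> substs L"
        using mgu by (rule mgu_in_substs)
      let ?h = "h @ [(N, i, Some (c', \<theta>))]" and ?N = "resolvent N i c' \<theta>"
      have "vars_query (take i N) \<subseteq> used_vars h N" "vars_query (drop (Suc i) N) \<subseteq> used_vars h N"
        by (auto simp: used_vars_def vars_query_def dest!: in_set_takeD in_set_dropD)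
      then have "subst_query \<mu> (take i N) = subst_query \<eta> (take i N)"
        "subst_query \<mu> (drop (Suc i) N) = subst_query \<eta> (drop (Suc i) N)"
        using \<mu>(2) by (auto intro!: subst_query_cong)
      then have "subst_query \<delta> ?N =
          subst_query \<eta> (take i N) @ body d @ subst_query \<eta> (drop (Suc i) N)"
        using \<mu>(3) by (auto simp: resolvent_def subst_query_comp[symmetric] \<delta>(2)[symmetric])
          (auto simp: subst_query_def subst_clause_def)
      then have "list_all2 supp (subst_query \<delta> ?N) (take i ns @ ms @ drop (Suc i) ns)"
        using rest d(4) by (auto intro!: list_all2_appendI)
      \<comment> \<open>Replacing the proof of the selected atom by those of the body literals saves
        one clause application.\<close>
      moreover have "sum_list (take i ns @ ms @ drop (Suc i) ns) < sum_list ns"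
        using sum d(3) by simp
      moreover have "non_diverging t"
        using nd T kid by (auto intro: non_diverging_subtree subtrees.intros)
      moreover have "?N \<in> queries L"
        using N clause_variant_in_clauses[OF P c(1)] fresh \<theta>
        by (auto simp: fresh_variant_def intro: resolvent_in_queries)
      moreover have "finite (used_vars ?h ?N)"
        using fin finite_vars_subst[OF \<theta>] by (simp add: used_vars_def)
      ultimately obtain \<rho> \<xi> where \<rho>: "branch_subst t \<rho>" "\<xi> \<in> substs L"
          "\<forall>x\<in>used_vars ?h ?N. \<delta> x = subst_trm \<xi> (\<rho> x)"
        using less.hyps[OF _ t] \<delta>(1) by blast
      \<comment> \<open>The variables of \<open>\<theta> x\<close> are among \<open>x\<close> and
        those of \<open>\<theta>\<close>, all of them used at the child, so the agreement obtained
        there extends to \<open>\<theta> x\<close>.\<close>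
      have "\<eta> x = subst_trm \<xi> (subst_comp \<theta> \<rho> x)" if x: "x \<in> used_vars h N" for x
      proof -
        have "vars_trm (\<theta> x) \<subseteq> insert x (vars_subst \<theta>)"
          by (cases "\<theta> x = Var x") (auto simp: vars_subst_def dom_subst_def)
        then have "vars_trm (\<theta> x) \<subseteq> used_vars ?h ?N"
          using x by (auto simp: used_vars_def)
        then have "subst_trm \<delta> (\<theta> x) = subst_trm (subst_comp \<rho> \<xi>) (\<theta> x)"
          using \<rho>(3) by (intro subst_trm_cong) (auto simp: subst_comp_def)
        then show ?thesis
          using \<mu>(2) x \<delta>(2) by (simp add: subst_comp_def subst_trm_comp[unfolded subst_comp_def])
      qed
      with \<rho>(1,2) T kid show ?thesis
        by (auto intro: branch_subst.intros)
    next
      case (Neg A)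
      from supp_i have A: "vars_atom (subst_atom \<gamma> (subst_atom \<eta> A)) = {}"
        "Pos (subst_atom \<gamma> (subst_atom \<eta> A)) \<notin> WF L P"
        unfolding supp_def by (cases; simp add: Neg)+
      \<comment> \<open>Otherwise the ground instance of \<open>A\<close> under
        \<open>\<eta>\<close> and \<open>\<gamma>\<close> would be true, against the leaf condition.
        The literal is dealt with because the tree has no floundered leaf, so it is removed.\<close>
      have not_mg: "\<not> succeeds_mg L S [Pos A]"
        using succeeds_mg_ground_instance[OF sls, of A "subst_comp \<eta> \<gamma>"] A atoms Neg
          subst_comp_in_substs[OF \<eta> \<gamma>] by (auto simp: subst_atom_comp)
      have not_floundered: "T \<noteq> Floundered N"
        using nd by (auto simp: non_diverging_def intro: subtrees.intros)
      from tree obtain t where T: "T = Remove N t"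
        and t: "sls_tree_at L P S \<R> (h @ [(N, i, None)]) (take i N @ drop (Suc i) N) t"
        by cases (use Neg False not_mg not_floundered in \<open>auto simp: i_def\<close>)
      let ?h = "h @ [(N, i, None)]" and ?N = "take i N @ drop (Suc i) N"
      have "list_all2 supp (subst_query \<eta> ?N) (take i ns @ drop (Suc i) ns)"
        using rest by (auto simp: subst_query_def intro!: list_all2_appendI)
      moreover have "ns ! i > 0"
        using supp_i unfolding supp_def by cases auto
      then have "sum_list (take i ns @ drop (Suc i) ns) < sum_list ns"
        using sum by simp
      moreover have "non_diverging t"
        using nd T by (auto intro: non_diverging_subtree subtrees.intros)
      moreover have "finite (used_vars ?h ?N)"
        using fin by (simp add: used_vars_def)
      ultimately obtain \<rho> \<xi> where \<rho>: "branch_subst t \<rho>" "\<xi> \<in> substs L"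
          "\<forall>x\<in>used_vars ?h ?N. \<eta> x = subst_trm \<xi> (\<rho> x)"
        using less.hyps[OF _ t] removed_in_queries[OF N] \<eta> by blast
      moreover have "used_vars h N \<subseteq> used_vars ?h ?N"
        by (auto simp: used_vars_def)
      ultimately show ?thesis
        using T by (blast intro: branch_subst.intros)
    qed
  qed
qed

text \<open>Lifting from the root: falsity is tested on one ground instance, yet the answer covers
  the possibly non-ground instance by \<open>\<theta>\<close>.\<close>

lemma (in separation) nonfalse_computed_answer:
  assumes sls: "sls_resolution L P S" and P: "P \<subseteq> clauses L"
    and tree: "main_sls_tree L P S Q \<R> t" "non_diverging t"
    and Q: "Q \<in> queries L" "\<theta> \<in> substs L" "vars_query (subst_query \<theta> Q) \<subseteq> V"
    and args: "\<And>l. l \<in> set (subst_query \<theta> Q) \<Longrightarrow> args (atom_of l) \<subseteq> T"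
    and nonfalse: "\<And>l. l \<in> set (subst_query \<gamma> (subst_query \<theta> Q)) \<Longrightarrow> compl_lit l \<notin> WF L P"
  shows "\<exists>\<rho> \<xi>. branch_subst t \<rho> \<and> \<xi> \<in> substs L \<and>
    subst_query \<theta> Q = subst_query \<xi> (subst_query \<rho> Q)"
proof -
  have "subst_query \<theta> Q \<in> queries L"
    using Q by (auto intro!: subst_query_in_queries substs_in_trms)
  then obtain ns where "list_all2 (supported (instances L P)
      (\<lambda>B. vars_atom (subst_atom \<gamma> B) = {} \<and> Pos (subst_atom \<gamma> B) \<notin> WF L P)) (subst_query \<theta> Q) ns"
    using nonfalse_query_supported[OF P _ Q(3) args nonfalse] by blast
  moreover have "is_selection_rule \<R>" "sls_tree_at L P S \<R> [] Q t"
    using tree(1) by (simp_all add: main_sls_tree_def)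
  moreover have "finite (used_vars [] Q)"
    by (simp add: used_vars_def)
  ultimately obtain \<rho> \<xi> where "branch_subst t \<rho>" "\<xi> \<in> substs L"
      and *: "\<forall>x\<in>used_vars [] Q. \<theta> x = subst_trm \<xi> (\<rho> x)"
    using lifting[OF sls P _ \<gamma>_in_substs _ tree(2) Q(1) _ Q(2)] by blast
  moreover from * have "subst_query \<theta> Q = subst_query (subst_comp \<rho> \<xi>) Q"
    by (intro subst_query_cong) (simp add: used_vars_def subst_comp_def)
  ultimately show ?thesis
    by (auto simp: subst_query_comp)
qed

section \<open>Separating terms in an extended language\<close>

text \<open>The length of the leftmost path. Unlike the maximal depth, it changes under a
  substitution by the depth of the term put in at the leftmost leaf, if that leaf is a variable, and
  by nothing otherwise.\<close>

fun depth :: "'f trm \<Rightarrow> nat" where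
  "depth (Var x) = 0"
| "depth (Fun f []) = 0"
| "depth (Fun f (t # ts)) = Suc (depth t)"

lemma depth_le_size: "depth t \<le> size t"
  by (induction t rule: depth.induct) auto

lemma depth_subst:
  "depth (subst_trm \<theta> t) = depth t \<or>
   (\<exists>y\<in>vars_trm t. depth (subst_trm \<theta> t) = depth t + depth (\<theta> y))"
  by (induction t rule: depth.induct) auto

text \<open>Nests an \<open>f\<close> of arity \<open>Suc n\<close> along its first argument and
  fills the other \<open>n\<close> arguments with a constant.\<close>

fun tower :: "'f \<Rightarrow> nat \<Rightarrow> 'f \<Rightarrow> nat \<Rightarrow> 'f trm" where
  "tower f n a 0 = Fun a []"
| "tower f n a (Suc k) = Fun f (tower f n a k # replicate n (Fun a []))"

lemma depth_tower [simp]: "depth (tower f n a k) = k"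
  by (induction k) auto

lemma vars_tower [simp]: "vars_trm (tower f n a k) = {}"
  by (induction k) auto

lemma tower_in_trms:
  "(a, 0) \<in> funs L \<Longrightarrow> (f, Suc n) \<in> funs L \<Longrightarrow> tower f n a k \<in> trms L"
  by (induction k) (auto simp: trms_def)

lemma exists_separation:
  assumes L: "is_language L" and P: "finite P" and ext: "extended_language L P Qs"
    and V: "finite V" and F: "finite F"
  shows "\<exists>g. separation L P V {t. vars_trm t \<subseteq> V \<and> funs_trm t \<subseteq> F \<and> size t \<le> M} g"
  using ext unfolding extended_language_def
proof (elim disjE exE conjE)
  assume inf: "infinite {a. (a, 0) \<in> funs L}"
  \<comment> \<open>The new constants must avoid the clauses, to be uninspectable, and
    \<open>F\<close>, so that no compound term of the separated set has one of them as root.\<close>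
  let ?used = "F \<union> (\<Union>c\<in>P. funs_clause c)"
  have "finite (fst ` ?used)"
    using P F by simp
  from Diff_infinite_finite[OF this inf]
  have "infinite ({a. (a, 0) \<in> funs L} - fst ` ?used)" .
  then obtain a :: "nat \<Rightarrow> 'a" where a: "inj a" "range a \<subseteq> {a. (a, 0) \<in> funs L} - fst ` ?used"
    using infinite_countable_subset by blast
  have a_funs: "(a x, 0) \<in> funs L" and a_fresh: "(a x, k) \<notin> ?used" for x k
    using a(2) by force+
  have "separation L P V {t. vars_trm t \<subseteq> V \<and> funs_trm t \<subseteq> F \<and> size t \<le> M} (\<lambda>x. Fun (a x) [])"
  proof
    show "inj_on (\<lambda>x. Fun (a x) []) V"
      using a(1) by (auto simp: inj_on_def)
  next
    fix h ts assume "Fun h ts \<in> {t. vars_trm t \<subseteq> V \<and> funs_trm t \<subseteq> F \<and> size t \<le> M}"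
    then show "set ts \<subseteq> {t. vars_trm t \<subseteq> V \<and> funs_trm t \<subseteq> F \<and> size t \<le> M}"
      by (auto simp: UN_subset_iff)
         (metis Suc_leD le_trans order_refl size_list_estimation')
  next
    fix h ts assume "Fun h ts \<in> {t. vars_trm t \<subseteq> V \<and> funs_trm t \<subseteq> F \<and> size t \<le> M}"
    with a_fresh show "subst_trm (ground_by V (\<lambda>x. Fun (a x) [])) (Fun h ts) \<notin> (\<lambda>x. Fun (a x) []) ` V"
      by auto
  qed (use V a_funs a_fresh in \<open>auto simp: trms_def\<close>)
  then show ?thesis by blast
next
  fix f n assume n: "0 < n" and f: "(f, n) \<in> funs L" "\<forall>c\<in>P. (f, n) \<notin> funs_clause c"
  obtain a where a: "(a, 0) \<in> funs L"
    using L by (auto simp: is_language_def)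
  \<comment> \<open>The symbol \<open>f\<close> may occur in \<open>F\<close>, so separation rests
    on depth: terms of the set have depth at most \<open>M\<close>, the towers have distinct
    positive multiples of \<open>Suc M\<close>. \<open>Suc x\<close> makes \<open>f\<close> the root
    even for \<open>x = 0\<close>; \<open>n - 1\<close> leaves room for the nested argument.\<close>
  define g where "g x = tower f (n - 1) a (Suc x * Suc M)" for x
  have depth_g: "depth (g x) = Suc x * Suc M" for x
    unfolding g_def by (rule depth_tower)
  let ?T = "{t. vars_trm t \<subseteq> V \<and> funs_trm t \<subseteq> F \<and> size t \<le> M}"
  have "separation L P V ?T g"
  proof
    show "inj_on g V"
    proof (rule inj_onI)
      fix x y assume "g x = g y"
      then have "Suc x * Suc M = Suc y * Suc M"
        by (metis depth_g)
      then show "x = y" by (simp only: mult_cancel2) simp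
    qed
  next
    fix h ts assume "Fun h ts \<in> ?T"
    then show "set ts \<subseteq> ?T"
      by (auto simp: UN_subset_iff)
         (metis Suc_leD le_trans order_refl size_list_estimation')
  next
    fix h ts assume T: "Fun h ts \<in> ?T"
    let ?t = "Fun h ts"
    have d: "depth ?t \<le> M"
      using T depth_le_size[of ?t] by simp
    show "subst_trm (ground_by V g) ?t \<notin> g ` V"
    proof
      assume "subst_trm (ground_by V g) ?t \<in> g ` V"
      then obtain x where x: "depth (subst_trm (ground_by V g) ?t) = Suc x * Suc M"
        using depth_g by (metis (no_types, lifting) imageE)
      \<comment> \<open>A tower is deeper than \<open>M\<close>, so the leftmost leaf must be a
        variable \<open>y\<close> replaced by another tower.\<close>
      have "depth (subst_trm (ground_by V g) ?t) \<noteq> depth ?t"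
        using d unfolding x by simp
      then obtain y where y: "y \<in> vars_trm ?t"
          "depth (subst_trm (ground_by V g) ?t) = depth ?t + depth (ground_by V g y)"
        using depth_subst by blast
      then have "Suc x * Suc M = depth ?t + Suc y * Suc M"
        using x T by (auto simp: ground_by_def depth_g)
      \<comment> \<open>Modulo \<open>Suc M\<close> both towers vanish. What remains forces
        \<open>?t\<close> to be a constant, which contains no \<open>y\<close>.\<close>
      then have "(Suc x * Suc M) mod Suc M = (depth ?t + Suc y * Suc M) mod Suc M"
        by (rule arg_cong)
      then have "depth ?t = 0"
        using d by (simp only: mod_mult_self1 mod_mult_self2_is_0 mod_less less_Suc_eq_le)
      then have "ts = []" by (cases ts) auto
      with y(1) show False by simp
    qed
  next
    fix x
    show "g x \<in> trms L"
      unfolding g_def using a f n by (intro tower_in_trms) auto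
    show "\<exists>f ts. g x = Fun f ts \<and> (\<forall>c\<in>P. (f, length ts) \<notin> funs_clause c)"
      using f n by (simp add: g_def)
    show "vars_trm (g x) = {}"
      unfolding g_def by (rule vars_tower)
  qed (rule V)
  then show ?thesis by blast
qed

text \<open>With \<open>V\<close> empty, abstraction is the identity; this serves for ground
  instances of a query.\<close>

lemma separation_ground: "separation L P {} UNIV g"
  by unfold_locales auto

section \<open>Semi-completeness\<close>

lemma rename_atom_eq [simp]: "inj r \<Longrightarrow> rename_atom r A = rename_atom r B \<longleftrightarrow> A = B"
  by (cases A; cases B) (auto dest: injD)

lemma inj_primed [simp]: "inj Plain" "inj Primed"
  by (auto intro: injI)

lemma rename_atom_Plain_Primed [simp]: "rename_atom Plain A \<noteq> rename_atom Primed B"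
  "rename_atom Primed A \<noteq> rename_atom Plain B"
  by (cases A; cases B; simp)+

lemma Plain_in_spec_interp [simp]: "rename_atom Plain A \<in> spec_interp Snf St \<longleftrightarrow> A \<in> St"
  and Primed_in_spec_interp [simp]: "rename_atom Primed A \<in> spec_interp Snf St \<longleftrightarrow> A \<in> Snf"
  by (auto simp: spec_interp_def)

lemma subst_rename_atom: "subst_atom \<theta> (rename_atom r A) = rename_atom r (subst_atom \<theta> A)"
  by (cases A) simp

lemma vars_rename_atom: "vars_atom (rename_atom r A) = vars_atom A"
  by (cases A) simp

lemma subst_primed_query:
  "subst_query \<theta> (map prime_lit Q) = map prime_lit (subst_query \<theta> Q)"
  "subst_query \<theta> (map dprime_lit Q) = map dprime_lit (subst_query \<theta> Q)"
proof -
  have "subst_lit \<theta> (prime_lit l) = prime_lit (subst_lit \<theta> l)"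
    "subst_lit \<theta> (dprime_lit l) = dprime_lit (subst_lit \<theta> l)" for l :: "('a, 'b) lit"
    by (cases l; simp add: subst_rename_atom)+
  then show "subst_query \<theta> (map prime_lit Q) = map prime_lit (subst_query \<theta> Q)"
    "subst_query \<theta> (map dprime_lit Q) = map dprime_lit (subst_query \<theta> Q)"
    by (simp_all add: subst_query_def)
qed

lemma vars_primed_query:
  "vars_query (map prime_lit Q) = vars_query Q" "vars_query (map dprime_lit Q) = vars_query Q"
proof -
  have "vars_atom (atom_of (prime_lit l)) = vars_atom (atom_of l)"
    "vars_atom (atom_of (dprime_lit l)) = vars_atom (atom_of l)" for l :: "('a, 'b) lit"
    by (cases l; simp add: vars_rename_atom)+
  then show "vars_query (map prime_lit Q) = vars_query Q"
    "vars_query (map dprime_lit Q) = vars_query Q"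
    by (simp_all add: vars_query_def)
qed

text \<open>Under double priming, positive literals are read in \<open>Snf\<close>, outside of which
  correctness places all false atoms, and negative ones in \<open>St\<close>, which contains all
  true atoms.\<close>

lemma dprime_not_false:
  assumes "correct_wfs L P Snf St" "true2_lit (spec_interp Snf St) (dprime_lit l)"
  shows "compl_lit l \<notin> WF L P"
  using assms by (cases l) (auto simp: correct_wfs_def)

text \<open>The dual reading: true atoms lie in \<open>St\<close>, false ones outside
  \<open>Snf\<close>.\<close>

lemma WF_prime:
  assumes "correct_wfs L P Snf St" "l \<in> WF L P"
  shows "true2_lit (spec_interp Snf St) (prime_lit l)"
  using assms by (cases l) (auto simp: correct_wfs_def)

section \<open>Success branches and failure of trees\<close>

lemma branch_subst_subtree:
  "t \<in> subtrees T \<Longrightarrow> branch_subst t \<rho> \<Longrightarrow> \<exists>\<rho>. branch_subst T \<rho>"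
  by (induction arbitrary: \<rho> rule: subtrees.induct) (auto dest: branch_subst.intros(2,3))

lemma branch_subst_Success: "branch_subst T \<rho> \<Longrightarrow> Success \<in> subtrees T"
  by (induction rule: branch_subst.induct) (blast intro: subtrees.intros subtrees_trans)+

text \<open>Without floundered leaves, a leaf that is not failed is a success node, and a success
  node lies at finite depth, so it ends a branch with a computed substitution.\<close>

lemma tree_fails_iff:
  assumes "non_diverging T"
  shows "tree_fails T \<longleftrightarrow> (\<nexists>\<rho>. branch_subst T \<rho>)"
proof
  assume "tree_fails T"
  then show "\<nexists>\<rho>. branch_subst T \<rho>"
    using branch_subst_Success unfolding tree_fails_def by fastforce
next
  assume *: "\<nexists>\<rho>. branch_subst T \<rho>"
  show "tree_fails T"
    unfolding tree_fails_def
  proof (intro ballI impI)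
    fix t assume t: "t \<in> subtrees T" "is_leaf t"
    with * have "t \<noteq> Success"
      using branch_subst_subtree branch_subst.intros(1) by blast
    moreover have "\<forall>N. t \<noteq> Floundered N"
      using t(1) assms by (simp add: non_diverging_def)
    ultimately show "\<exists>N. t = Failed N"
      using t(2) by (cases t) simp_all
  qed
qed

lemma correct_imp_computed_answer:
  assumes L: "is_language L" and P: "is_program L P" and ext: "extended_language L P Qs"
    and sls: "sls_resolution L P S" and corr: "correct_wfs L P Snf St"
    and tree: "main_sls_tree L P S Q \<R> T" "non_diverging T"
    and Q: "Q \<in> queries L" "\<theta> \<in> substs L"
    and models: "models2 L (spec_interp Snf St) (dprime (Conj (subst_query \<theta> Q)))"
  shows "\<exists>R. computed_answer T Q R \<and> more_general L R (subst_query \<theta> Q)"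
proof -
  let ?Q = "subst_query \<theta> Q"
  let ?args = "\<Union>l\<in>set ?Q. args (atom_of l)"
  have "finite (args A)" for A :: "('a, 'b) atom"
    by (cases A) simp
  then have "finite (size ` ?args)" by simp
  \<comment> \<open>This bound on the arguments fixes how large the separating terms must
    be.\<close>
  then obtain M where M: "\<forall>t\<in>?args. size t \<le> M"
    by (meson finite_nat_set_iff_bounded_le imageI)
  have args: "args (atom_of l) \<subseteq>
      {t. vars_trm t \<subseteq> vars_query ?Q \<and> funs_trm t \<subseteq> funs_query ?Q \<and> size t \<le> M}"
    if l: "l \<in> set ?Q" for l
  proof
    fix t assume t: "t \<in> args (atom_of l)"
    then have "vars_trm t \<subseteq> vars_atom (atom_of l)" "funs_trm t \<subseteq> funs_atom (atom_of l)"
      by (cases "atom_of l"; auto)+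
    moreover have "vars_atom (atom_of l) \<subseteq> vars_query ?Q" "funs_atom (atom_of l) \<subseteq> funs_query ?Q"
      using l by (auto simp: vars_query_def funs_query_def)
    moreover have "size t \<le> M"
      using M l t by blast
    ultimately show
      "t \<in> {t. vars_trm t \<subseteq> vars_query ?Q \<and> funs_trm t \<subseteq> funs_query ?Q \<and> size t \<le> M}"
      by blast
  qed
  obtain g where g: "separation L P (vars_query ?Q)
      {t. vars_trm t \<subseteq> vars_query ?Q \<and> funs_trm t \<subseteq> funs_query ?Q \<and> size t \<le> M} g"
    using exists_separation[OF L _ ext finite_vars_query finite_funs_query] P
    unfolding is_program_def by blast
  then interpret separation L P "vars_query ?Q"
      "{t. vars_trm t \<subseteq> vars_query ?Q \<and> funs_trm t \<subseteq> funs_query ?Q \<and> size t \<le> M}" g .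
  \<comment> \<open>Truth in the specification is used at this one ground instance; by correctness
    none of its literals is false in the model.\<close>
  have "vars_query (subst_query \<gamma> ?Q) = {}"
    using g_ground by (simp add: vars_subst_query[of \<gamma>] ground_by_def)
  then have "compl_lit l \<notin> WF L P" if "l \<in> set (subst_query \<gamma> ?Q)" for l
    using models that \<gamma>_in_substs
    by (intro dprime_not_false[OF corr]) (auto simp: subst_primed_query vars_primed_query)
  moreover have "P \<subseteq> clauses L"
    using P by (simp add: is_program_def)
  ultimately show ?thesis
    using nonfalse_computed_answer[OF sls _ tree Q order_refl args]
    unfolding computed_answer_def more_general_def by blast
qed

lemma computed_answer_sound:
  assumes L: "is_language L" and P: "is_program L P" and sls: "sls_resolution L P S"
    and tree: "main_sls_tree L P S Q \<R> T" and Q: "Q \<in> queries L"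
    and "computed_answer T Q R" "\<xi> \<in> substs L"
  shows "models3 L (WF L P) (Conj (subst_query \<xi> R))"
  unfolding models3_Conj_WF
proof (intro ballI impI)
  fix \<theta> assume "\<theta> \<in> substs L" "vars_query (subst_query \<theta> (subst_query \<xi> R)) = {}"
  then obtain \<eta> where \<eta>: "grounding L \<eta>"
      "subst_query \<eta> (subst_query \<xi> R) = subst_query \<theta> (subst_query \<xi> R)"
    using grounding_extend[OF L] by blast
  obtain \<rho> where \<rho>: "branch_subst T \<rho>" "R = subst_query \<rho> Q"
    using assms(6) by (auto simp: computed_answer_def)
  have "grounding L (subst_comp \<xi> \<eta>)"
    using \<eta>(1) assms(7) by (intro grounding_comp substs_in_trms)
  then have "set (subst_query (subst_comp \<rho> (subst_comp \<xi> \<eta>)) Q) \<subseteq> WF L P"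
    using branch_subst_sound[OF sls _ _ _ \<rho>(1) _ Q] P tree
    by (auto simp: is_program_def main_sls_tree_def)
  then show "set (subst_query \<theta> (subst_query \<xi> R)) \<subseteq> WF L P"
    using \<eta>(2) by (simp add: subst_query_comp \<rho>(2))
qed

text \<open>A success branch would yield a ground instance with all literals in the model.
  Correctness makes the primed instance true in the specification, which refutes it.\<close>

lemma correct_imp_tree_fails:
  assumes L: "is_language L" and P: "is_program L P"
    and sls: "sls_resolution L P S" and corr: "correct_wfs L P Snf St"
    and tree: "main_sls_tree L P S Q \<R> T" "non_diverging T" and Q: "Q \<in> queries L"
    and models: "models2 L (spec_interp Snf St) (prime (NotConj Q))"
  shows "tree_fails T"
  unfolding tree_fails_iff[OF tree(2)]
proof
  assume "\<exists>\<rho>. branch_subst T \<rho>"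
  then obtain \<rho> where "computed_answer T Q (subst_query \<rho> Q)" and \<rho>: "branch_subst T \<rho>"
    by (auto simp: computed_answer_def)
  obtain \<eta> where "grounding L \<eta>"
    using exists_grounding[OF L] by blast
  then have \<beta>: "grounding L (subst_comp \<rho> \<eta>)" "set (subst_query (subst_comp \<rho> \<eta>) Q) \<subseteq> WF L P"
    using branch_subst_sound[OF sls _ _ _ \<rho> _ Q] P tree(1)
    by (auto simp: is_program_def main_sls_tree_def)
  obtain \<theta> where \<theta>: "\<theta> \<in> substs L" "\<forall>x\<in>vars_query Q. \<theta> x = subst_comp \<rho> \<eta> x"
    using grounding_restrict[OF \<beta>(1) finite_vars_query] by blast
  then have "subst_query \<theta> Q = subst_query (subst_comp \<rho> \<eta>) Q"
    by (intro subst_query_cong) simp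
  then have "set (subst_query \<theta> Q) \<subseteq> WF L P" "vars_query (subst_query \<theta> Q) = {}"
    using \<beta> by (auto simp: vars_subst_query grounding_def)
  with models \<theta>(1) WF_prime[OF corr] show False
    by (auto simp: subst_primed_query vars_primed_query)
qed

text \<open>A ground instance without a false literal would lift to a success branch.\<close>

lemma tree_fails_sound:
  assumes P: "is_program L P" and sls: "sls_resolution L P S"
    and tree: "main_sls_tree L P S Q \<R> T" "non_diverging T" and Q: "Q \<in> queries L"
    and "tree_fails T"
  shows "models3 L (WF L P) (NotConj Q)"
  unfolding models3_NotConj_WF
proof (intro ballI impI, rule ccontr)
  fix \<theta> assume \<theta>: "\<theta> \<in> substs L" "vars_query (subst_query \<theta> Q) = {}"
    and *: "\<not> (\<exists>l\<in>set (subst_query \<theta> Q). compl_lit l \<in> WF L P)"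
  \<comment> \<open>The instance is already ground, so nothing is left to separate.\<close>
  have "subst_query (ground_by {} Var) (subst_query \<theta> Q) = subst_query Var (subst_query \<theta> Q)"
    by (rule subst_query_cong) (simp add: ground_by_def)
  with * have "\<And>l. l \<in> set (subst_query (ground_by {} Var) (subst_query \<theta> Q)) \<Longrightarrow> compl_lit l \<notin> WF L P"
    by auto
  then have "\<exists>\<rho>. branch_subst T \<rho>"
    using separation.nonfalse_computed_answer[OF separation_ground sls _ tree Q \<theta>(1)] P \<theta>(2)
    by (metis is_program_def subset_UNIV order_refl)
  with assms(6) tree_fails_iff[OF tree(2)] show False by blast
qed

theorem theorem4:
  fixes L :: "('f, 'p) language"
    and P :: "('f, 'p) clause set"
    and S :: "('f, 'p) sls"
    and Qs :: "('f, 'p) query set"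
    and Snf St :: "('f, 'p) atom set"
  assumes "is_language L"
    and "is_program L P"
    and "Qs \<subseteq> queries L"
    and "extended_language L P Qs"
    and "is_specification L Snf St"
    and "sls_resolution L P S"
    and "correct_wfs L P Snf St"
  shows "sls_semi_complete L P S Qs Snf St \<and> semi_complete_wfs L P S Qs Snf St"
proof
  show "sls_semi_complete L P S Qs Snf St"
    unfolding sls_semi_complete_def
  proof (intro ballI allI impI conjI; elim conjE)
    fix Q \<R> T \<theta>
    assume "Q \<in> Qs" and tree: "main_sls_tree L P S Q \<R> T" "non_diverging T" and \<theta>: "\<theta> \<in> substs L"
    then have Q: "Q \<in> queries L"
      using assms(3) by blast
    {
      assume "models2 L (spec_interp Snf St) (dprime (Conj (subst_query \<theta> Q)))"
      then show "\<exists>R. computed_answer T Q R \<and> more_general L R (subst_query \<theta> Q)"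
        by (rule correct_imp_computed_answer[OF assms(1,2,4,6,7) tree Q \<theta>])
    next
      assume "models2 L (spec_interp Snf St) (prime (NotConj Q))"
      then show "tree_fails T"
        by (rule correct_imp_tree_fails[OF assms(1,2,6,7) tree Q])
    }
  qed
  show "semi_complete_wfs L P S Qs Snf St"
    unfolding semi_complete_wfs_def complete_for_wfs_def
  proof (intro ballI impI conjI)
    fix Q assume "Q \<in> Qs" and "\<exists>\<R> T. main_sls_tree L P S Q \<R> T \<and> non_diverging T"
    then obtain \<R> T where tree: "main_sls_tree L P S Q \<R> T" "non_diverging T" by blast
    have Q: "Q \<in> queries L"
      using \<open>Q \<in> Qs\<close> assms(3) by blast
    {
      assume "models2 L (spec_interp Snf St) (dprime (Conj Q))"
      \<comment> \<open>With \<open>Var\<close> as instantiating substitution, \<open>Q\<close>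
        itself is an instance of a computed answer and inherits its truth.\<close>
      then obtain R \<xi> where "computed_answer T Q R" "\<xi> \<in> substs L" "Q = subst_query \<xi> R"
        using correct_imp_computed_answer[OF assms(1,2,4,6,7) tree Q, of Var]
        by (auto simp: more_general_def simp del: dprime.simps models2.simps)
      with computed_answer_sound[OF assms(1,2,6) tree(1) Q]
      show "models3 L (WF L P) (Conj Q)" by metis
    next
      assume "models2 L (spec_interp Snf St) (prime (NotConj Q))"
      with correct_imp_tree_fails[OF assms(1,2,6,7) tree Q]
      show "models3 L (WF L P) (NotConj Q)"
        using tree_fails_sound[OF assms(2,6) tree Q] by blast
    }
  qed
qed

end
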